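(* Let $q,a,b,\xi>0$. If $X\sim\mathrm{GG}(\xi^{1/q},d=1,q)$ and $Y\sim\mathrm{GB2}(q,\phi(q),a,b)$ are independent random variables, then $$\theta=X/Y\sim\mathrm{Gambel}(\theta\mid q,a,b,\xi).$$
   Context: $\Gamma$ is the Gamma function, $B(a,b)$ the Beta function, and $\phi(q)=\sqrt{\Gamma(3/q)/\Gamma(1/q)}$. $\mathrm{GG}(x\mid a,d,q)$ (Generalised Gamma), $a,d,q>0$, is the distribution on $\mathbb{R}^+=(0,\infty)$ with density $$\frac{q}{a^d\,\Gamma(d/q)}x^{d-1}\exp\left(-\left(\frac xa\right)^q\right);$$ the arguments in $\mathrm{GG}(\cdot,\cdot,\cdot)$ are listed in the order $(a,d,q)$. $\mathrm{GB2}(x\mid p,q,a,b)$ (Generalised Beta of the second kind), $p,q,a,b>0$, is the distribution on $\mathbb{R}^+$ with density $$\frac{p\,(x/q)^{ap-1}\left(1+(x/q)^p\right)^{-(a+b)}}{q\,B(a,b)};$$ the arguments are listed in the order $(p,q,a,b)$. The distribution $\mathrm{Gambel}(\theta\mid q,a,b,\xi)$ is the distribution on $\mathbb{R}^+$ with density $$\frac{\Gamma\left(a+\frac1q\right)}{\Gamma\left(\frac1q\right)}\,\frac{q}{B(a,b)}\,\frac{\phi(q)}{\xi^{1/q}}\,\Psi\left(a+\tfrac1q,\;1+\tfrac1q-b,\;\frac{(\phi(q)\,\theta)^q}{\xi}\right)\qquad(\theta>0).$$ $\Psi(x,y,z)$ is the Tricomi confluent hypergeometric function, given for $y\notin\mathbb{Z}$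 by $$\Psi(x,y,z)=\frac{\pi}{\sin(\pi y)}\left\{\frac{M(x,y,z)}{\Gamma(1+x-y)\Gamma(y)}-z^{1-y}\frac{M(1+x-y,2-y,z)}{\Gamma(x)\Gamma(2-y)}\right\},$$ with $M$ the Kummer confluent hypergeometric function, and for integer $y$ by continuity in $y$. *)

theory Defs
  imports "HOL-Probability.Probability"
begin

definition kummer_M :: "real \<Rightarrow> real \<Rightarrow> real \<Rightarrow> real" where
  "kummer_M x y z = (\<Sum>n. pochhammer x n / pochhammer y n * (z ^ n / fact n))"

text \<open>
  At the poles \<^term>\<open>Gamma\<close> is 0 by convention, so that dividing by it gives 0 there, in
  agreement with the entire function \<^term>\<open>rGamma\<close>. The formula is only meaningful for
  \<^term>\<open>y \<notin> \<int>\<close> and \<^term>\<open>z > 0\<close>.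
\<close>
definition tricomi_nonint :: "real \<Rightarrow> real \<Rightarrow> real \<Rightarrow> real" where
  "tricomi_nonint x y z =
     pi / sin (pi * y) *
       (kummer_M x y z / (Gamma (1 + x - y) * Gamma y)
        - z powr (1 - y) * (kummer_M (1 + x - y) (2 - y) z / (Gamma x * Gamma (2 - y))))"

text \<open>
  At integer \<^term>\<open>y\<close> the function is extended by continuity in its second argument. The limit
  is over a punctured neighbourhood of \<^term>\<open>y\<close>, so only non-integer values matter.
\<close>
definition tricomi_Psi :: "real \<Rightarrow> real \<Rightarrow> real \<Rightarrow> real" where
  "tricomi_Psi x y z =
     (if y \<in> \<int> then Lim (at y) (\<lambda>y'. tricomi_nonint x y' z) else tricomi_nonint x y z)"

definition phi :: "real \<Rightarrow> real" where
  "phi q = sqrt (Gamma (3 / q) / Gamma (1 / q))"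

definition GG_density :: "real \<Rightarrow> real \<Rightarrow> real \<Rightarrow> real \<Rightarrow> real" where
  "GG_density a d q x =
     (if 0 < x then q / (a powr d * Gamma (d / q)) * x powr (d - 1) * exp (- ((x / a) powr q))
      else 0)"

definition GB2_density :: "real \<Rightarrow> real \<Rightarrow> real \<Rightarrow> real \<Rightarrow> real \<Rightarrow> real" where
  "GB2_density p q a b x =
     (if 0 < x
      then p * (x / q) powr (a * p - 1) * (1 + (x / q) powr p) powr (- (a + b)) / (q * Beta a b)
      else 0)"

definition Gambel_density :: "real \<Rightarrow> real \<Rightarrow> real \<Rightarrow> real \<Rightarrow> real \<Rightarrow> real" where
  "Gambel_density q a b \<xi> \<theta> =
     (if 0 < \<theta>
      then Gamma (a + 1 / q) / Gamma (1 / q) * (q / Beta a b) * (phi q / \<xi> powr (1 / q))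
           * tricomi_Psi (a + 1 / q) (1 + 1 / q - b) ((phi q * \<theta>) powr q / \<xi>)
      else 0)"

end

theory Submission
  imports Defs "HOL-Real_Asymp.Real_Asymp"
begin

text \<open>
  Conditioning on $Y$ and substituting $y = \phi(q)\,t^{1/q}$ turns the density of $X/Y$ into a
  multiple of $J(x,c,z) = \int_0^\infty t^{x-1}(1+t)^{-c}e^{-zt}\,dt$ with $x = a + 1/q$ and
  $c = a + b$, so everything rests on $\Gamma(x)\,\Psi(x,y,z) = J(x,c,z)$ for $y = 1+x-c$.

  For $y \notin \mathbb{Z}$, both $J$ and the two Kummer terms of $\Gamma(x)\,\Psi$ obey
  $F(x,c) = F(x,c+1) + F(x+1,c+1)$, $x\,F(x,c) = c\,F(x+1,c+1) + z\,F(x+1,c)$ and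
  $\partial_z F(x,c) = -F(x+1,c)$. The first two reduce the identity to the strip $0 < y < 1$;
  together they imply Kummer's differential equation. On the strip, the Wronskian of the difference
  of the two sides with the positive solution $M(x,y,z)$ is a multiple of $z^{-y}e^z$, and the
  behaviour at $z \to 0$ forces first the Wronskian and then the difference to vanish.
  Integer $y$ follows because $J$ is continuous in $c$.
\<close>

section \<open>The regularised Kummer function\<close>

text \<open>The strip is the range of $y$ on which both boundary values of the integral at $z = 0$
  are finite: $J(x,c,z)$ converges to a Beta value because $y < 1$, and $z^y J(x+1,c,z)$ converges
  to \<open>Gamma y\<close> because $y > 0$. For $y \<ge> 1$ the first limit is infinite, for $y
  \<le> 0$ the second. Kummer's equation has a two-dimensional solution space; on the strip one
  fundamental solution tends to a nonzero constant and the other behaves like $z^{1-y}$, so the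
  first limit detects one coefficient of a solution and the second limit the other. That both
  coefficients of $J$ agree with those in \<Psi> is Euler's reflection formula, used once for each.
  The factor $1/sin(pi y)$ cannot be dropped along the way: its change of sign under unit shifts of
  $y$ is what gives the two Kummer terms the same relations as $J$. Leaving the strip changes $x$
  and $c$ together, so the identity on the strip has to be available for all admissible pairs at
  once.\<close>

text \<open>The series is $M(p,r,z)/\Gamma(r)$, which is entire in $r$.\<close>
definition reg_kummer :: "real \<Rightarrow> real \<Rightarrow> real \<Rightarrow> real" where
  "reg_kummer p r z = (\<Sum>n. pochhammer p n * rGamma (r + of_nat n) / fact n * z ^ n)"

text \<open>Ratio test: since $rGamma(r+n) = (r+n) rGamma(r+n+1)$, consecutive terms have a ratio of
  absolute value $|p+n| |z| / ((n+1) |r+n|)$, which tends to 0 for every real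
  \<open>r\<close>.\<close>

lemma summable_reg_kummer:
  "summable (\<lambda>n. pochhammer p n * rGamma (r + of_nat n) / fact n * z ^ n :: real)"
proof -
  \<comment> \<open>Beyond this bound $r+n$ is positive and at least $2(|p|+1)|z|$. As $|p+n| \<le>
    (|p|+1)(n+1)$, the ratio is then at most 1/2.\<close>
  obtain N :: nat where N: "real N > 2 * (\<bar>p\<bar> + 1) * \<bar>z\<bar> + \<bar>r\<bar> + 1"
    using reals_Archimedean2 by blast
  have "norm (pochhammer p (Suc n) * rGamma (r + real (Suc n)) / fact (Suc n) * z ^ Suc n)
      \<le> 1/2 * norm (pochhammer p n * rGamma (r + real n) / fact n * z ^ n)" if "n \<ge> N" for n
  proof -
    have n: "real n > 2 * (\<bar>p\<bar> + 1) * \<bar>z\<bar> + \<bar>r\<bar> + 1"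
      using N that by linarith
    moreover have "2 * (\<bar>p\<bar> + 1) * \<bar>z\<bar> \<ge> 0" by simp
    ultimately have pos: "r + real n > 0" and ge: "r + real n \<ge> 2 * (\<bar>p\<bar> + 1) * \<bar>z\<bar>"
      by linarith+
    have rg: "rGamma (r + real n) = (r + real n) * rGamma (r + real (Suc n))"
      using rGamma_plus1[of "r + real n"] by (simp add: add_ac)
    have "\<bar>p + real n\<bar> \<le> (\<bar>p\<bar> + 1) * real (Suc n)"
      by (simp add: algebra_simps) (smt (verit) mult_nonneg_nonneg of_nat_0_le_iff abs_ge_zero)
    hence "\<bar>p + real n\<bar> * \<bar>z\<bar> \<le> (\<bar>p\<bar> + 1) * real (Suc n) * \<bar>z\<bar>"
      by (intro mult_right_mono) auto
    also have "\<dots> = (\<bar>p\<bar> + 1) * \<bar>z\<bar> * real (Suc n)"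
      by (simp only: mult_ac)
    also have "\<dots> \<le> (r + real n) / 2 * real (Suc n)"
      using ge by (intro mult_right_mono) (auto simp: algebra_simps)
    finally have le: "\<bar>p + real n\<bar> * \<bar>z\<bar> / real (Suc n) \<le> (r + real n) / 2"
      by (simp add: field_simps)
    define K where "K = \<bar>pochhammer p n\<bar> * \<bar>rGamma (r + real (Suc n))\<bar> / fact n * \<bar>z\<bar> ^ n"
    have "K \<ge> 0" by (simp add: K_def)
    have "norm (pochhammer p (Suc n) * rGamma (r + real (Suc n)) / fact (Suc n) * z ^ Suc n)
        = \<bar>p + real n\<bar> * \<bar>z\<bar> / real (Suc n) * K"
      unfolding K_def by (simp add: pochhammer_Suc abs_mult power_abs divide_simps del: of_nat_Suc)
    also have "\<dots> \<le> (r + real n) / 2 * K"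
      by (intro mult_right_mono le \<open>K \<ge> 0\<close>)
    also have "\<dots> = 1/2 * norm (pochhammer p n * rGamma (r + real n) / fact n * z ^ n)"
      unfolding K_def rg using pos by (simp add: abs_mult power_abs)
    finally show ?thesis .
  qed
  thus ?thesis by (intro summable_ratio_test[of "1/2" N]) simp_all
qed

lemma reg_kummer_sums:
  "(\<lambda>n. pochhammer p n * rGamma (r + of_nat n) / fact n * z ^ n) sums reg_kummer p r z"
  unfolding reg_kummer_def by (rule summable_sums[OF summable_reg_kummer])

lemma reg_kummer_0: "reg_kummer p r 0 = rGamma r"
  using sums_unique2[OF reg_kummer_sums[of p r 0] powser_sums_zero] by simp

text \<open>All terms of the series are positive. This is the source of the positive comparison
  solution on the strip.\<close>

lemma reg_kummer_pos:
  assumes "p > 0" "r > 0" "z > 0"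
  shows "reg_kummer p r z > 0"
  unfolding reg_kummer_def
proof (rule suminf_pos[OF summable_reg_kummer])
  show "0 < pochhammer p n * rGamma (r + real n) / fact n * z ^ n" for n
    using assms by (intro mult_pos_pos divide_pos_pos pochhammer_pos)
      (auto simp: rGamma_inverse_Gamma intro!: Gamma_real_pos)
qed

lemma has_field_derivative_reg_kummer:
  "(reg_kummer p r has_real_derivative p * reg_kummer (p + 1) (r + 1) z) (at z)"
proof -
  define f where "f n = pochhammer p n * rGamma (r + of_nat n) / fact n" for n
  have d: "((\<lambda>z. \<Sum>n. f n * z ^ n) has_real_derivative (\<Sum>n. diffs f n * z ^ n)) (at z)"
    by (rule termdiffs_strong[of _ "norm z + 1"]) (auto simp: f_def simp del: times_divide_eq_left intro: summable_reg_kummer)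
  have "diffs f n = p * (pochhammer (p + 1) n * rGamma (r + 1 + of_nat n) / fact n)" for n
    by (simp add: diffs_def f_def pochhammer_rec add_ac divide_simps)
  hence "(\<lambda>n. diffs f n * z ^ n) = (\<lambda>n. p * (pochhammer (p + 1) n * rGamma (r + 1 + of_nat n) / fact n * z ^ n))"
    by (simp add: fun_eq_iff)
  hence "(\<lambda>n. diffs f n * z ^ n) sums (p * reg_kummer (p + 1) (r + 1) z)"
    using sums_mult[OF reg_kummer_sums] by metis
  hence "(\<Sum>n. diffs f n * z ^ n) = p * reg_kummer (p + 1) (r + 1) z"
    by (simp add: sums_iff)
  moreover have "(\<lambda>z. \<Sum>n. f n * z ^ n) = reg_kummer p r"
    by (simp add: fun_eq_iff f_def reg_kummer_def)
  ultimately show ?thesis using d by simp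
qed

lemma continuous_reg_kummer: "isCont (reg_kummer p r) z"
  using has_field_derivative_reg_kummer DERIV_isCont by blast

text \<open>Comparison of coefficients: $p (p+1)_n = (p+n) (p)_n$, and $p+n = (r-1+n) + (1+p-r)$,
  where the factor $r-1+n$ turns $rGamma(r+n)$ into $rGamma(r-1+n)$.\<close>

lemma reg_kummer_contiguous_lower:
  "p * reg_kummer (p + 1) r z = reg_kummer p (r - 1) z + (1 + p - r) * reg_kummer p r z"
proof (rule sums_unique2)
  show "(\<lambda>n. p * (pochhammer (p + 1) n * rGamma (r + of_nat n) / fact n * z ^ n)) sums
      (p * reg_kummer (p + 1) r z)"
    by (intro sums_mult reg_kummer_sums)
  have eq: "p * pochhammer (p + 1) n * rGamma (r + of_nat n) = pochhammer p n * rGamma (r - 1 + of_nat n)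
      + (1 + p - r) * (pochhammer p n * rGamma (r + of_nat n))" for n
  proof -
    have "p * pochhammer (p + 1) n = (p + of_nat n) * pochhammer p n"
      by (metis mult.commute pochhammer_Suc pochhammer_rec)
    moreover have "rGamma (r - 1 + of_nat n) = (r - 1 + of_nat n) * rGamma (r + of_nat n)"
      using rGamma_plus1[of "r - 1 + of_nat n"] by (simp add: algebra_simps)
    ultimately have "p * pochhammer (p + 1) n * rGamma (r + of_nat n) =
        (p + of_nat n) * (pochhammer p n * rGamma (r + of_nat n))"
      "pochhammer p n * rGamma (r - 1 + of_nat n) = (r - 1 + of_nat n) * (pochhammer p n * rGamma (r + of_nat n))"
      by simp_all
    thus ?thesis by (simp add: algebra_simps)
  qed
  have "(\<lambda>n. p * (pochhammer (p + 1) n * rGamma (r + of_nat n) / fact n * z ^ n)) =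
     (\<lambda>n. pochhammer p n * rGamma (r - 1 + of_nat n) / fact n * z ^ n
      + (1 + p - r) * (pochhammer p n * rGamma (r + of_nat n) / fact n * z ^ n))"
    (is "?l = ?r")
  proof
    fix n
    have "?l n = (p * pochhammer (p + 1) n * rGamma (r + of_nat n)) * (z ^ n / fact n)"
      by simp
    also have "\<dots> = ?r n"
      unfolding eq by (simp add: algebra_simps add_divide_distrib diff_divide_distrib)
    finally show "?l n = ?r n" .
  qed
  thus "(\<lambda>n. p * (pochhammer (p + 1) n * rGamma (r + of_nat n) / fact n * z ^ n)) sums
     (reg_kummer p (r - 1) z + (1 + p - r) * reg_kummer p r z)"
    by (simp only:) (intro sums_add sums_mult reg_kummer_sums)
qed

text \<open>Comparison of coefficients: $(p+1)_n - (p)_n = n (p+1)_{n-1}$, and the factor $n$ lowers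
  the factorial by one.\<close>

lemma reg_kummer_contiguous_upper:
  "reg_kummer (p + 1) r z = reg_kummer p r z + z * reg_kummer (p + 1) (r + 1) z"
proof (rule sums_unique2[OF reg_kummer_sums])
  let ?g = "\<lambda>n. pochhammer (p + 1) n * rGamma (r + 1 + of_nat n) / fact n * z ^ n"
  \<comment> \<open>The terms of the second series after multiplication by \<open>z\<close>, moved
    up by one index, so that the term at index 0 is 0.\<close>
  define h where "h n = (case n of 0 \<Rightarrow> 0 | Suc m \<Rightarrow> z * ?g m)" for n
  have "(\<lambda>n. h (Suc n)) sums (z * reg_kummer (p + 1) (r + 1) z)"
    unfolding h_def nat.case by (intro sums_mult reg_kummer_sums)
  hence "h sums (z * reg_kummer (p + 1) (r + 1) z)"
    by (subst (asm) sums_Suc_iff) (simp add: h_def)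
  hence "(\<lambda>n. pochhammer p n * rGamma (r + of_nat n) / fact n * z ^ n + h n) sums
      (reg_kummer p r z + z * reg_kummer (p + 1) (r + 1) z)"
    by (intro sums_add reg_kummer_sums)
  moreover have "pochhammer p n * rGamma (r + of_nat n) / fact n * z ^ n + h n =
      pochhammer (p + 1) n * rGamma (r + of_nat n) / fact n * z ^ n" for n
  proof (cases n)
    case (Suc m)
    have 1: "pochhammer p n = p * pochhammer (p + 1) m"
      by (simp add: Suc pochhammer_rec)
    have 2: "pochhammer (p + 1) n = (p + 1 + of_nat m) * pochhammer (p + 1) m"
      by (simp add: Suc pochhammer_Suc)
    have 3: "r + 1 + of_nat m = r + of_nat n" by (simp add: Suc)
    have 4: "h n = z ^ n * pochhammer (p + 1) m * rGamma (r + of_nat n) / fact m"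
      by (simp add: h_def Suc add_ac)
    have 5: "fact n = (1 + of_nat m) * (fact m :: real)" by (simp add: Suc)
    show ?thesis
      unfolding 1 2 4 5 by (simp add: divide_simps add_nonneg_eq_0_iff) (simp add: algebra_simps)
  qed (simp add: h_def)
  ultimately show "(\<lambda>n. pochhammer (p + 1) n * rGamma (r + of_nat n) / fact n * z ^ n) sums
      (reg_kummer p r z + z * reg_kummer (p + 1) (r + 1) z)"
    by simp
qed

lemma kummer_M_eq_reg_kummer:
  assumes "r \<notin> \<int>\<^sub>\<le>\<^sub>0"
  shows "kummer_M p r z = Gamma r * reg_kummer p r z"
proof -
  have "pochhammer p n / pochhammer r n * (z ^ n / fact n) =
      Gamma r * (pochhammer p n * rGamma (r + of_nat n) / fact n * z ^ n)" for n
  proof -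
    have "pochhammer r n = Gamma (r + of_nat n) / Gamma r"
      using pochhammer_Gamma assms by blast
    thus ?thesis by (simp add: rGamma_inverse_Gamma field_simps)
  qed
  thus ?thesis
    unfolding kummer_M_def reg_kummer_def
    using suminf_mult[OF summable_reg_kummer] by presburger
qed

section \<open>Families satisfying the contiguous relations\<close>

text \<open>
  The second parameter of the confluent hypergeometric functions is encoded by $y = 1 + x - c$;
  in the variables $x$ and $c$, the three relations have no coefficients depending on $y$.
\<close>
locale tricomi_family =
  fixes F :: "real \<Rightarrow> real \<Rightarrow> real \<Rightarrow> real"
  assumes split: "\<lbrakk>x > 0; c > 0; z > 0; x - c \<notin> \<int>\<rbrakk> \<Longrightarrow> F x c z = F x (c + 1) z + F (x + 1) (c + 1) z"
    and parts: "\<lbrakk>x > 0; c > 0; z > 0; x - c \<notin> \<int>\<rbrakk> \<Longrightarrow>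
      x * F x c z = c * F (x + 1) (c + 1) z + z * F (x + 1) c z"
    and deriv: "\<lbrakk>x > 0; c > 0; z > 0; x - c \<notin> \<int>\<rbrakk> \<Longrightarrow>
      (F x c has_real_derivative - F (x + 1) c z) (at z)"
begin

text \<open>Raising \<open>x\<close> by one amounts to $-d/dz$, so this reads $z F'' + (y-z) F' - x
  F = 0$ with $y = 1+x-c$. The terms with $c+1$ are eliminated from \<open>parts\<close> at $x+1$,
  \<open>split\<close> at $x+1$ and \<open>parts\<close> at $x$.\<close>

lemma kummer_ode:
  assumes "x > 0" "c > 0" "z > 0" "x - c \<notin> \<int>"
  shows "z * F (x + 2) c z = (1 + x - c - z) * F (x + 1) c z + x * F x c z"
proof -
  have n: "x + 1 - c \<notin> \<int>"
    using assms(4) Ints_diff[of "x + 1 - c" 1] by (auto simp: algebra_simps)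
  have "(x + 1) * F (x + 1) c z = c * F (x + 2) (c + 1) z + z * F (x + 2) c z"
    using parts[of "x + 1" c z] n assms by (simp add: add.assoc)
  moreover have "F (x + 1) c z = F (x + 1) (c + 1) z + F (x + 2) (c + 1) z"
    using split[of "x + 1" c z] n assms by (simp add: add.assoc)
  hence "c * F (x + 1) c z = c * F (x + 1) (c + 1) z + c * F (x + 2) (c + 1) z"
    by (simp add: distrib_left)
  moreover have "x * F x c z = c * F (x + 1) (c + 1) z + z * F (x + 1) c z"
    using parts assms by blast
  ultimately show ?thesis by (simp add: algebra_simps)
qed

lemma deriv':
  assumes "x > 0" "c > 0" "z > 0" "x - c \<notin> \<int>"
  shows "(F (x + 1) c has_real_derivative - F (x + 2) c z) (at z)"
proof -
  have "x + 1 - c \<notin> \<int>"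
    using assms(4) Ints_diff[of "x + 1 - c" 1] by (auto simp: algebra_simps)
  thus ?thesis using deriv[of "x + 1" c z] assms by (simp add: add.assoc)
qed

text \<open>In terms of $y = 1+x-c$, the three terms of \<open>split\<close> lie at $y$, $y-1$, $y$
  and those of \<open>parts\<close> at $y$, $y$, $y+1$. Vanishing therefore passes from the strip
  between \<open>k\<close> and \<open>k + 1\<close> to both neighbours, and induction over the
  integers reaches every non-integer $y$.\<close>

lemma eq_0_if_eq_0_on_strip:
  assumes strip: "\<And>x c. \<lbrakk>x > 0; c > 0; 0 < 1 + x - c; 1 + x - c < 1\<rbrakk> \<Longrightarrow> F x c z = 0"
    and z: "z > 0" and xc: "x > 0" "c > 0" "x - c \<notin> \<int>"
  shows "F x c z = 0"
proof -
  define P where "P k \<longleftrightarrow> (\<forall>x c. x > 0 \<longrightarrow> c > 0 \<longrightarrow> of_int k < 1 + x - c \<longrightarrow> 1 + x - c < of_int (k + 1) \<longrightarrow> F x c z = 0)"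
    for k :: int
  have nonint: "x - c \<notin> \<int>" if "of_int k < 1 + x - c" "1 + x - c < of_int (k + 1)" for x c :: real and k :: int
  proof
    assume "x - c \<in> \<int>"
    then obtain m where m: "x - c = of_int m" by (auto elim: Ints_cases)
    have "real_of_int k < of_int (1 + m)" "real_of_int (1 + m) < of_int (k + 1)"
      unfolding of_int_add of_int_1 m[symmetric] using that by (simp_all add: algebra_simps)
    thus False unfolding of_int_less_iff by simp
  qed
  have up: "P (k + 1)" if k: "P k" for k
  proof -
    have vanish: "F x c z = 0" if "x > 0" "c > 0" "of_int k < 1 + x - c" "1 + x - c < of_int (k + 1)" for x c :: real
      using k that unfolding P_def by blast
    \<comment> \<open>Solving \<open>parts\<close> for its last term reaches the strip above, but
      only with first parameter greater than 1. Then \<open>split\<close> covers all positive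
      \<open>x\<close>: of its two terms on the right, one lies in strip \<open>k\<close> and the
      other has first parameter \<open>x + 1\<close>.\<close>
    have big: "F (x + 1) c z = 0"
      if "x > 0" "c > 0" "of_int (k + 1) < 2 + x - c" "2 + x - c < of_int (k + 2)" for x c :: real
    proof -
      have "F x c z = 0" "F (x + 1) (c + 1) z = 0"
        using that by (auto intro!: vanish)
      with parts[of x c z] that z nonint[of k x c] show ?thesis by simp
    qed
    show ?thesis unfolding P_def
    proof (intro allI impI)
      fix x c :: real assume *: "x > 0" "c > 0" "of_int (k + 1) < 1 + x - c" "1 + x - c < of_int (k + 1 + 1)"
      have "F x (c + 1) z = 0" using * by (intro vanish) auto
      moreover have "F (x + 1) (c + 1) z = 0" using * by (intro big) auto
      ultimately show "F x c z = 0"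
        using split[of x c z] z * nonint[of "k + 1" x c] by simp
    qed
  qed
  have down: "P (k - 1)" if k: "P k" for k
  proof -
    have vanish: "F x c z = 0" if "x > 0" "c > 0" "of_int k < 1 + x - c" "1 + x - c < of_int (k + 1)" for x c :: real
      using k that unfolding P_def by blast
    \<comment> \<open>The mirror image: \<open>split\<close> reaches the strip below only with
      second parameter greater than 1, and \<open>parts\<close> removes this restriction.\<close>
    have big: "F x (c + 1) z = 0"
      if "x > 0" "c > 0" "of_int (k - 1) < x - c" "x - c < of_int k" for x c :: real
    proof -
      have "F x c z = 0" "F (x + 1) (c + 1) z = 0"
        using that by (auto intro!: vanish)
      with split[of x c z] that z nonint[of k x c] show ?thesis by simp
    qed
    show ?thesis unfolding P_def
    proof (intro allI impI)
      fix x c :: real assume *: "x > 0" "c > 0" "of_int (k - 1) < 1 + x - c" "1 + x - c < of_int (k - 1 + 1)"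
      have "F (x + 1) c z = 0" using * by (intro vanish) auto
      moreover have "F (x + 1) (c + 1) z = 0" using * by (intro big) auto
      ultimately show "F x c z = 0"
        using parts[of x c z] z * nonint[of "k - 1" x c] by simp
    qed
  qed
  have all: "P k" for k
  proof (induction k rule: int_induct[where k = 0])
    case base
    show ?case unfolding P_def using strip by simp
  next
    case (step1 i) thus ?case by (intro up)
  next
    case (step2 i) thus ?case by (intro down)
  qed
  define k where "k = \<lfloor>1 + x - c\<rfloor>"
  have "1 + x - c \<notin> \<int>"
    using xc(3) Ints_diff[of "1 + x - c" 1] by (auto simp: algebra_simps)
  hence "of_int k < 1 + x - c" "1 + x - c < of_int (k + 1)"
    unfolding k_def using floor_correct[of "1 + x - c"] by (auto simp: less_le)
  with all[of k] xc show ?thesis unfolding P_def by simp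
qed

end

text \<open>The three relations are linear and homogeneous, with coefficients that do not depend on
  the family.\<close>

lemma tricomi_family_diff_cmult:
  assumes "tricomi_family F" "tricomi_family G"
  shows "tricomi_family (\<lambda>x c z. F x c z - k * G x c z)"
proof -
  interpret F: tricomi_family F by fact
  interpret G: tricomi_family G by fact
  show ?thesis
  proof
    fix x c z :: real assume *: "x > 0" "c > 0" "z > 0" "x - c \<notin> \<int>"
    show "F x c z - k * G x c z = F x (c + 1) z - k * G x (c + 1) z
        + (F (x + 1) (c + 1) z - k * G (x + 1) (c + 1) z)"
      using F.split[OF *] G.split[OF *] by (simp add: algebra_simps)
    have "x * (k * G x c z) = k * (c * G (x + 1) (c + 1) z + z * G (x + 1) c z)"
      using G.parts[OF *] by simp
    thus "x * (F x c z - k * G x c z) = c * (F (x + 1) (c + 1) z - k * G (x + 1) (c + 1) z) +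
        z * (F (x + 1) c z - k * G (x + 1) c z)"
      using F.parts[OF *] by (simp add: algebra_simps)
    show "((\<lambda>z. F x c z - k * G x c z) has_real_derivative
        - (F (x + 1) c z - k * G (x + 1) c z)) (at z)"
      using DERIV_diff[OF F.deriv[OF *] DERIV_cmult[OF G.deriv[OF *], of k]] by simp
  qed
qed

section \<open>Uniqueness on the strip through the Wronskian\<close>

lemma eq_limit_0_if_deriv_eq_0:
  fixes f :: "real \<Rightarrow> real"
  assumes "\<And>z. z > 0 \<Longrightarrow> (f has_real_derivative 0) (at z)" "(f \<longlongrightarrow> L) (at_right 0)" "z > 0"
  shows "f z = L"
proof -
  have "\<exists>k. \<forall>w\<in>{0<..}. f w = k"
    using assms(1) by (intro has_field_derivative_zero_constant)
      (auto intro: has_field_derivative_at_within)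
  hence "f w = f z" if "w > 0" for w
    using that assms(3) by auto
  hence "eventually (\<lambda>w. f w = f z) (at_right 0)"
    by (auto simp: eventually_at_filter)
  with assms(2) have "((\<lambda>_::real. f z) \<longlongrightarrow> L) (at_right 0)"
    by (rule Lim_transform_eventually)
  thus ?thesis
    by (simp add: tendsto_const_iff)
qed

text \<open>\<open>H\<close> is a positive comparison solution with a positive limit at 0. The two
  limits assumed of \<open>D\<close> are its boundary data: they make the Wronskian vanish, so that
  \<open>D / H\<close> is constant, and this constant is the limit 0.\<close>

lemma tricomi_family_eq_0:
  assumes D: "tricomi_family D" and H: "tricomi_family H"
    and x: "x > 0" and c: "c > 0" and y: "0 < 1 + x - c" "1 + x - c < 1"
    and Hpos: "\<And>z. z > 0 \<Longrightarrow> H x c z > 0"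
    and limH: "(H x c \<longlongrightarrow> h) (at_right 0)" "h > 0"
    and limH': "(H (x + 1) c \<longlongrightarrow> h') (at_right 0)"
    and limD: "(D x c \<longlongrightarrow> 0) (at_right 0)"
    and limD': "((\<lambda>z. z powr (1 + x - c) * D (x + 1) c z) \<longlongrightarrow> 0) (at_right 0)"
    and z: "z > 0"
  shows "D x c z = 0"
proof -
  interpret D: tricomi_family D by fact
  interpret H: tricomi_family H by fact
  define y where "y = 1 + x - c"
  have xc: "x - c \<notin> \<int>"
  proof
    assume "x - c \<in> \<int>"
    then obtain m where "x - c = of_int m" by (auto elim: Ints_cases)
    with y have "real_of_int 0 < of_int (1 + m)" "real_of_int (1 + m) < of_int 1"
      unfolding of_int_add of_int_1 of_int_0 by linarith+
    thus False unfolding of_int_less_iff by simp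
  qed
  \<comment> \<open>The Wronskian $D' H - D H'$, since replacing \<open>x\<close> by
    \<open>x + 1\<close> gives the negative derivative.\<close>
  define W where "W z = D x c z * H (x + 1) c z - D (x + 1) c z * H x c z" for z
  \<comment> \<open>The prefactor is the integrating factor for $W' = (1 - y/z) W$, so
    \<open>V\<close> is constant.\<close>
  define V where "V z = z powr y * exp (- z) * W z" for z
  have W': "(W has_real_derivative (1 - y / z) * W z) (at z)" if z: "z > 0" for z
  proof -
    have "(W has_real_derivative
        D (x + 2) c z * H x c z - D x c z * H (x + 2) c z) (at z)"
      unfolding W_def
      by (rule DERIV_cong[OF DERIV_diff[OF
            DERIV_mult[OF D.deriv[OF x c z xc] H.deriv'[OF x c z xc]]
            DERIV_mult[OF D.deriv'[OF x c z xc] H.deriv[OF x c z xc]]]]) (simp add: algebra_simps)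
    also have "D (x + 2) c z * H x c z - D x c z * H (x + 2) c z =
        ((z * D (x + 2) c z) * H x c z - D x c z * (z * H (x + 2) c z)) / z"
      using z by (simp add: field_simps)
    also have "\<dots> = (1 - y / z) * W z"
      unfolding D.kummer_ode[OF x c z xc] H.kummer_ode[OF x c z xc] W_def y_def
      using z by (simp add: field_simps)
    finally show ?thesis .
  qed
  have V': "(V has_real_derivative 0) (at z)" if z: "z > 0" for z
  proof -
    have "((\<lambda>z. z powr y * exp (- z)) has_real_derivative
        (y * z powr (y - 1) * exp (- z) - z powr y * exp (- z))) (at z)"
      using z by (auto intro!: derivative_eq_intros)
    hence "(V has_real_derivative (y * z powr (y - 1) * exp (- z) - z powr y * exp (- z)) * W z
        + z powr y * exp (- z) * ((1 - y / z) * W z)) (at z)"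
      unfolding V_def by (rule DERIV_cong[OF DERIV_mult[OF _ W'[OF z]]]) simp
    moreover have "z powr (y - 1) = z powr y / z" using z by (simp add: powr_diff)
    ultimately show ?thesis by (simp add: algebra_simps)
  qed
  have "(V \<longlongrightarrow> 0) (at_right 0)"
  proof -
    have 1: "((\<lambda>z. z powr y) \<longlongrightarrow> 0) (at_right 0)"
      using y unfolding y_def by real_asymp
    have 2: "((\<lambda>z::real. exp (- z)) \<longlongrightarrow> 1) (at_right 0)"
      by real_asymp
    \<comment> \<open>In the first product $z^y$ tends to 0 and all other factors have finite
      limits. In the second it must stay attached to \<open>D (x + 1) c z\<close>, which is only
      controlled after this scaling.\<close>
    have "((\<lambda>z. z powr y * exp (- z) * (D x c z * H (x + 1) c z)
        - exp (- z) * (z powr (1 + x - c) * D (x + 1) c z) * H x c z) \<longlongrightarrow>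
        0 * 1 * (0 * h') - 1 * 0 * h) (at_right 0)"
      by (intro tendsto_intros 1 2 limD limD' limH limH')
    thus ?thesis
      unfolding V_def W_def y_def by (simp add: algebra_simps)
  qed
  from eq_limit_0_if_deriv_eq_0[OF V' this] have W0: "W z = 0" if "z > 0" for z
    using that unfolding V_def by auto
  have "(\<lambda>z. D x c z / H x c z) z = 0"
  proof (rule eq_limit_0_if_deriv_eq_0[OF _ _ z])
    show "((\<lambda>z. D x c z / H x c z) has_real_derivative 0) (at z)" if "z > 0" for z
    proof -
      have H0: "H x c z \<noteq> 0" using Hpos[OF that] by simp
      show ?thesis
        using W0[OF that] unfolding W_def
        by (intro DERIV_cong[OF DERIV_divide[OF D.deriv[OF x c that xc] H.deriv[OF x c that xc] H0]])
          simp
    qed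
    show "((\<lambda>z. D x c z / H x c z) \<longlongrightarrow> 0) (at_right 0)"
      using tendsto_divide[OF limD limH(1)] limH(2) by simp
  qed
  thus ?thesis using Hpos[OF z] by simp
qed

section \<open>The two Kummer terms as solutions of the relations\<close>

lemma Gamma_add1_pos: "x > 0 \<Longrightarrow> Gamma (x + 1 :: real) = x * Gamma x"
  by (rule Gamma_plus1) (auto dest: nonpos_Ints_nonpos)

lemma sin_pi_add1: "sin (pi * (w + 1)) = - sin (pi * w)"
  by (simp add: distrib_left)

text \<open>The sine changes sign whenever $y = 1+x-c$ moves by one. These signs turn the contiguous
  relations of \<open>reg_kummer\<close> into those of the family.\<close>

lemma sin_pi_shifts:
  "sin (pi * (1 + x - (c + 1))) = - sin (pi * (1 + x - c))"
  "sin (pi * (1 + (x + 1) - (c + 1))) = sin (pi * (1 + x - c))"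
  "sin (pi * (1 + (x + 1) - c)) = - sin (pi * (1 + x - c))"
  using sin_pi_add1[of "x - c"] sin_pi_add1[of "1 + x - c"] by (simp_all add: add_ac add_diff_eq)

lemma sin_pi_shift_nonzero:
  assumes "x - c \<notin> \<int>"
  shows "sin (pi * (1 + x - c)) \<noteq> 0"
proof
  assume "sin (pi * (1 + x - c)) = 0"
  hence "1 + x - c \<in> \<int>" by (auto simp: sin_zero_iff_int2 mult.commute)
  hence "1 + x - c - 1 \<in> \<int>" by (rule Ints_diff) simp
  with assms show False by (simp add: algebra_simps)
qed

text \<open>
  For $y = 1+x-c$, the two summands of $\Gamma(x)\,\Psi(x,y,z)$ are $\pi$ times
  \<open>kummer_part\<close> and $-\pi$ times \<open>kummer_part'\<close>.
\<close>
definition kummer_part :: "real \<Rightarrow> real \<Rightarrow> real \<Rightarrow> real" where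
  "kummer_part x c z = Gamma x / Gamma c * reg_kummer x (1 + x - c) z / sin (pi * (1 + x - c))"

definition kummer_part' :: "real \<Rightarrow> real \<Rightarrow> real \<Rightarrow> real" where
  "kummer_part' x c z = z powr (c - x) * reg_kummer c (1 + c - x) z / sin (pi * (1 + x - c))"

text \<open>\<open>split\<close> comes from the lower contiguous relation and \<open>parts\<close>
  from the upper one; \<open>Gamma x / Gamma c\<close> absorbs the factors \<open>x\<close> and
  \<open>c\<close> under unit shifts.\<close>

lemma tricomi_family_kummer_part: "tricomi_family kummer_part"
proof
  fix x c z :: real assume *: "x > 0" "c > 0" "z > 0" "x - c \<notin> \<int>"
  note sins = sin_pi_shifts[of x c]
  have s: "sin (pi * (1 + x - c)) \<noteq> 0"
    using *(4) by (rule sin_pi_shift_nonzero)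
  have G: "Gamma x > 0" "Gamma c > 0" "Gamma (x + 1) = x * Gamma x" "Gamma (c + 1) = c * Gamma c"
    using * by (auto intro!: Gamma_real_pos Gamma_add1_pos)
  show "kummer_part x c z = kummer_part x (c + 1) z + kummer_part (x + 1) (c + 1) z"
  proof -
    have eq: "reg_kummer x (1 + x - (c + 1)) z = x * reg_kummer (x + 1) (1 + x - c) z - c * reg_kummer x (1 + x - c) z"
      using reg_kummer_contiguous_lower[of x "1 + x - c" z] by simp
    have r: "1 + (x + 1) - (c + 1) = 1 + x - c" by simp
    show ?thesis unfolding kummer_part_def sins G eq unfolding r using s G(1,2) *
      by (simp add: divide_simps) (simp add: algebra_simps)
  qed
  show "x * kummer_part x c z = c * kummer_part (x + 1) (c + 1) z + z * kummer_part (x + 1) c z"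
  proof -
    have r: "1 + (x + 1) - (c + 1) = 1 + x - c" by simp
    have "reg_kummer (x + 1) (1 + x - c) z = reg_kummer x (1 + x - c) z + z * reg_kummer (x + 1) (1 + (x + 1) - c) z"
      using reg_kummer_contiguous_upper[of x "1 + x - c" z] by (simp add: add_ac add_diff_eq)
    hence eq: "reg_kummer (x + 1) (1 + (x + 1) - (c + 1)) z = reg_kummer x (1 + x - c) z + z * reg_kummer (x + 1) (1 + (x + 1) - c) z"
      unfolding r .
    show ?thesis unfolding kummer_part_def sins G eq using s G *
      by (simp add: divide_simps) (simp add: algebra_simps)
  qed
  show "(kummer_part x c has_real_derivative - kummer_part (x + 1) c z) (at z)"
  proof -
    have "(kummer_part x c has_real_derivative Gamma x / Gamma c *
        (x * reg_kummer (x + 1) (1 + x - c + 1) z) / sin (pi * (1 + x - c))) (at z)"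
      unfolding kummer_part_def by (intro DERIV_cdivide DERIV_cmult has_field_derivative_reg_kummer)
    moreover have "1 + x - c + 1 = 1 + (x + 1) - c" by simp
    ultimately show ?thesis unfolding kummer_part_def[of "x + 1"] sins G by (simp add: mult_ac)
  qed
qed

text \<open>Here \<open>c\<close> is the upper parameter of the series, so the roles are exchanged:
  \<open>split\<close> comes from the upper relation and \<open>parts\<close> from the lower one.
  The derivative needs both, because the product rule also differentiates the power of
  \<open>z\<close>.\<close>

lemma tricomi_family_kummer_part': "tricomi_family kummer_part'"
proof
  fix x c z :: real assume *: "x > 0" "c > 0" "z > 0" "x - c \<notin> \<int>"
  note sins = sin_pi_shifts[of x c]
  have s: "sin (pi * (1 + x - c)) \<noteq> 0"
    using *(4) by (rule sin_pi_shift_nonzero)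
  have P: "z powr (c + 1 - x) = z * z powr (c - x)" "z powr (c - (x + 1)) = z powr (c - x) / z"
    "z powr (c + 1 - (x + 1)) = z powr (c - x)"
    using * by (simp_all add: powr_diff powr_add)
  have lower: "reg_kummer c (1 + c - (x + 1)) z = c * reg_kummer (c + 1) (1 + c - x) z - x * reg_kummer c (1 + c - x) z"
    using reg_kummer_contiguous_lower[of c "1 + c - x" z] by simp
  have upper: "reg_kummer (c + 1) (1 + c - x) z = reg_kummer c (1 + c - x) z + z * reg_kummer (c + 1) (1 + (c + 1) - x) z"
    using reg_kummer_contiguous_upper[of c "1 + c - x" z] by (simp add: algebra_simps)
  have r: "1 + (c + 1) - (x + 1) = 1 + c - x" by simp
  show "kummer_part' x c z = kummer_part' x (c + 1) z + kummer_part' (x + 1) (c + 1) z"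
    unfolding kummer_part'_def sins P r upper using s * by (simp add: divide_simps) (simp add: algebra_simps)
  show "x * kummer_part' x c z = c * kummer_part' (x + 1) (c + 1) z + z * kummer_part' (x + 1) c z"
    unfolding kummer_part'_def sins P r lower using s * by (simp add: divide_simps) (simp add: algebra_simps)
  show "(kummer_part' x c has_real_derivative - kummer_part' (x + 1) c z) (at z)"
  proof -
    have "((\<lambda>z. z powr (c - x)) has_real_derivative (c - x) * z powr (c - x - 1)) (at z)"
      using *(3) by (rule has_real_derivative_powr)
    hence d: "(kummer_part' x c has_real_derivative
        ((c - x) * z powr (c - x - 1) * reg_kummer c (1 + c - x) z +
         c * reg_kummer (c + 1) (1 + c - x + 1) z * z powr (c - x)) / sin (pi * (1 + x - c))) (at z)"
      unfolding kummer_part'_def by (intro DERIV_cdivide DERIV_mult has_field_derivative_reg_kummer)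
    have e: "1 + c - x + 1 = 1 + (c + 1) - x" "c - x - 1 = c - (x + 1)" by simp_all
    from d show ?thesis
      unfolding kummer_part'_def[of "x + 1"] e sins P lower upper using s *
      by (elim DERIV_cong) (simp add: divide_simps, simp add: algebra_simps)
  qed
qed

section \<open>The integral representation\<close>

text \<open>The integrand is the norm of the complex Gamma integrand, which is absolutely
  integrable.\<close>

lemma set_integrable_powr_exp:
  fixes x z :: real
  assumes "x > 0" "z > 0"
  shows "set_integrable lborel {0<..} (\<lambda>t. t powr (x - 1) * exp (- (z * t)))"
proof -
  let ?f = "\<lambda>t. complex_of_real t powr (of_real x - 1) / of_real (exp (z * t))"
  have "?f absolutely_integrable_on {0<..}"
    using absolutely_integrable_Gamma_integral[of "of_real x" z] assms by simp
  hence "set_integrable lebesgue {0<..} (\<lambda>t. norm (?f t))"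
    by (rule absolutely_integrable_norm[unfolded o_def])
  also have "?this \<longleftrightarrow> set_integrable lebesgue {0<..} (\<lambda>t. t powr (x - 1) * exp (- (z * t)))"
    by (rule set_integrable_cong)
      (auto simp: norm_divide norm_powr_real_powr exp_minus field_simps)
  finally show ?thesis
    unfolding set_integrable_def by (subst (asm) integrable_completion) auto
qed

lemma Gamma_eq_lborel_integral:
  assumes "x > (0::real)"
  shows "(LINT t:{0<..}|lborel. t powr (x - 1) * exp (- t)) = Gamma x"
proof -
  have "(LINT t:{0<..}|lborel. t powr (x - 1) * exp (- t)) =
      integral {0<..} (\<lambda>t. t powr (x - 1) * exp (- t))"
    using set_borel_integral_eq_integral(2)[OF set_integrable_powr_exp[OF assms zero_less_one]] by simp
  also have "((\<lambda>t. t powr (x - 1) / exp t) has_integral Gamma x) {0<..}"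
  proof (subst has_integral_spike_set_eq[where T = "{0..}"])
    show "((\<lambda>t. t powr (x - 1) / exp t) has_integral Gamma x) {0..}"
      by (rule Gamma_integral_real[OF assms])
    show "negligible {t \<in> {0..} - {0<..}. t powr (x - 1) / exp t \<noteq> 0}"
      by (rule negligible_subset[of "{0}"]) auto
    show "negligible {t \<in> {0<..} - {0..}. t powr (x - 1) / exp t \<noteq> 0}"
      by (rule negligible_subset[of "{0}"]) auto
  qed
  hence "integral {0<..} (\<lambda>t. t powr (x - 1) * exp (- t)) = Gamma x"
    by (simp add: integral_unique exp_minus divide_inverse)
  finally show ?thesis .
qed

text \<open>Dominated convergence for a real parameter, reduced to sequences. It serves
  differentiation in \<open>z\<close>, the limits at $z = 0$ and continuity in
  \<open>c\<close>.\<close>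

lemma tendsto_set_integral_dominated:
  fixes f :: "real \<Rightarrow> real \<Rightarrow> real"
  assumes g: "set_integrable lborel A g" and A: "A \<in> sets lborel"
    and f: "\<And>w. w \<in> S \<Longrightarrow> w \<noteq> z \<Longrightarrow> f w \<in> borel_measurable lborel"
    and l: "l \<in> borel_measurable lborel"
    and lim: "\<And>t. t \<in> A \<Longrightarrow> ((\<lambda>w. f w t) \<longlongrightarrow> l t) (at z within S)"
    and bound: "\<And>w t. w \<in> S \<Longrightarrow> w \<noteq> z \<Longrightarrow> t \<in> A \<Longrightarrow> \<bar>f w t\<bar> \<le> g t"
  shows "((\<lambda>w. LINT t:A|lborel. f w t) \<longlongrightarrow> (LINT t:A|lborel. l t)) (at z within S)"
  unfolding tendsto_at_iff_sequentially
proof (intro allI impI)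
  fix X assume X: "\<forall>i. X i \<in> S - {z}" "X \<longlonglongrightarrow> z"
  show "((\<lambda>w. LINT t:A|lborel. f w t) \<circ> X) \<longlonglongrightarrow> (LINT t:A|lborel. l t)"
    unfolding o_def set_lebesgue_integral_def
  proof (rule integral_dominated_convergence[where w = "\<lambda>t. indicator A t *\<^sub>R g t"])
    show "(\<lambda>t. indicat_real A t *\<^sub>R l t) \<in> borel_measurable lborel"
      using l A by measurable
    show "(\<lambda>t. indicat_real A t *\<^sub>R f (X i) t) \<in> borel_measurable lborel" for i
    proof -
      have "f (X i) \<in> borel_measurable lborel" using X by (intro f) auto
      thus ?thesis using A by measurable
    qed
    show "integrable lborel (\<lambda>t. indicat_real A t *\<^sub>R g t)"
      using g by (simp add: set_integrable_def)
    show "AE t in lborel. (\<lambda>i. indicat_real A t *\<^sub>R f (X i) t) \<longlonglongrightarrow> indicat_real A t *\<^sub>R l t"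
    proof (rule AE_I2)
      fix t
      show "(\<lambda>i. indicat_real A t *\<^sub>R f (X i) t) \<longlonglongrightarrow> indicat_real A t *\<^sub>R l t"
      proof (cases "t \<in> A")
        case True
        have "(\<lambda>i. f (X i) t) \<longlonglongrightarrow> l t"
          using lim[OF True] X unfolding tendsto_at_iff_sequentially o_def by blast
        thus ?thesis using True by simp
      qed simp
    qed
    show "AE t in lborel. norm (indicat_real A t *\<^sub>R f (X i) t) \<le> indicat_real A t *\<^sub>R g t" for i
      using X bound by (intro AE_I2) (auto simp: indicator_def)
  qed
qed

section \<open>The integral $J$ and its three relations\<close>

definition tricomi_integral :: "real \<Rightarrow> real \<Rightarrow> real \<Rightarrow> real" where
  "tricomi_integral x c z =
     (LINT t:{0<..}|lborel. t powr (x - 1) * (1 + t) powr (- c) * exp (- (z * t)))"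

text \<open>For $c \<ge> 0$ the factor $(1+t)^{-c}$ is at most 1, which leaves a Gamma integrand.
  The case $c = 0$ provides the majorant for continuity in \<open>c\<close>.\<close>

lemma set_integrable_tricomi:
  fixes x c z :: real
  assumes "x > 0" "c \<ge> 0" "z > 0"
  shows "set_integrable lborel {0<..} (\<lambda>t. t powr (x - 1) * (1 + t) powr (- c) * exp (- (z * t)))"
proof (rule set_integrable_bound[OF set_integrable_powr_exp[OF assms(1,3)]])
  show "set_borel_measurable lborel {0<..} (\<lambda>t. t powr (x - 1) * (1 + t) powr (- c) * exp (- (z * t)))"
    unfolding set_borel_measurable_def by measurable
  have "(1 + t) powr (- c) \<le> 1" if "t > 0" for t
    using powr_mono[of "-c" 0 "1 + t"] that assms by simp
  hence "t powr (x - 1) * (1 + t) powr (- c) * exp (- (z * t)) \<le> t powr (x - 1) * 1 * exp (- (z * t))"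
    if "t > 0" for t
    using that by (intro mult_right_mono mult_left_mono) auto
  thus "AE t in lborel. t \<in> {0<..} \<longrightarrow> norm (t powr (x - 1) * (1 + t) powr (- c) * exp (- (z * t)))
      \<le> norm (t powr (x - 1) * exp (- (z * t)))"
    by (intro AE_I2) (auto simp: abs_mult)
qed

text \<open>The integrands already agree, by $(1+t)^{-c} = (1+t)(1+t)^{-(c+1)}$.\<close>

lemma tricomi_integral_split:
  assumes "x > 0" "c > 0" "z > 0"
  shows "tricomi_integral x c z = tricomi_integral x (c + 1) z + tricomi_integral (x + 1) (c + 1) z"
  unfolding tricomi_integral_def
proof (subst set_integral_add(2)[symmetric])
  show "set_integrable lborel {0<..} (\<lambda>t. t powr (x - 1) * (1 + t) powr (- (c + 1)) * exp (- (z * t)))"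
    "set_integrable lborel {0<..} (\<lambda>t. t powr (x + 1 - 1) * (1 + t) powr (- (c + 1)) * exp (- (z * t)))"
    using assms by (intro set_integrable_tricomi; simp)+
  have "t powr (x - 1) * (1 + t) powr (- c) = t powr (x - 1) * (1 + t) powr (- (c + 1)) + t powr (x + 1 - 1) * (1 + t) powr (- (c + 1))"
    if "t > 0" for t
  proof -
    have "(1 + t) powr (- c) = (1 + t) * (1 + t) powr (- (c + 1))"
      using powr_mult_base[of "1 + t" "-(c + 1)"] that by simp
    moreover have "t powr (x + 1 - 1) = t * t powr (x - 1)"
      using powr_mult_base[of t "x - 1"] that by simp
    ultimately show ?thesis by (simp add: algebra_simps)
  qed
  thus "(LINT t:{0<..}|lborel. t powr (x - 1) * (1 + t) powr (- c) * exp (- (z * t))) =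
    (LINT t:{0<..}|lborel. t powr (x - 1) * (1 + t) powr (- (c + 1)) * exp (- (z * t)) +
        t powr (x + 1 - 1) * (1 + t) powr (- (c + 1)) * exp (- (z * t)))"
    by (intro set_lebesgue_integral_cong) (auto simp: distrib_right)
qed

text \<open>The derivative of $t^x (1+t)^{-c} e^{-zt}$ has integral 0, because this function
  vanishes at both ends; \<open>f\<close> is that derivative.\<close>

lemma tricomi_integral_parts:
  assumes "x > 0" "c > 0" "z > 0"
  shows "x * tricomi_integral x c z = c * tricomi_integral (x + 1) (c + 1) z + z * tricomi_integral (x + 1) c z"
proof -
  let ?k = "\<lambda>x c t. t powr (x - 1) * (1 + t) powr (- c) * exp (- (z * t))"
  define f where "f t = x * ?k x c t - (c * ?k (x + 1) (c + 1) t + z * ?k (x + 1) c t)" for t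
  have int: "set_integrable lborel {0<..} (?k x c)" "set_integrable lborel {0<..} (?k (x + 1) (c + 1))"
    "set_integrable lborel {0<..} (?k (x + 1) c)"
    using assms by (intro set_integrable_tricomi; simp)+
  have "set_integrable lborel {0<..} (\<lambda>t. x * ?k x c t)"
    "set_integrable lborel {0<..} (\<lambda>t. c * ?k (x + 1) (c + 1) t + z * ?k (x + 1) c t)"
    using int by (intro set_integral_add(1) set_integrable_mult_right; simp)+
  note i = set_integral_diff[OF this]
  have f: "set_integrable lborel {0<..} f"
    unfolding f_def by (rule i(1))
  have "(LINT t:{0<..}|lborel. f t) = x * tricomi_integral x c z -
      (c * tricomi_integral (x + 1) (c + 1) z + z * tricomi_integral (x + 1) c z)"
    unfolding f_def i(2)
    using int(2,3) by (subst set_integral_add(2)) (simp_all add: tricomi_integral_def)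
  moreover have "(LBINT t=ereal 0..\<infinity>. f t) = 0 - 0"
  proof (rule interval_integral_FTC_integrable[where F = "\<lambda>t. t powr x * (1 + t) powr (- c) * exp (- (z * t))"])
    show "((\<lambda>t. t powr x * (1 + t) powr (- c) * exp (- (z * t))) has_vector_derivative f t) (at t)"
      if "ereal 0 < ereal t" for t
    proof -
      have t: "t > 0" "1 + t > 0" using that by auto
      have e: "- (c + 1) = - c - 1" "x + 1 - 1 = x" by simp_all
      have "((\<lambda>t. t powr x * (1 + t) powr (- c) * exp (- (z * t))) has_real_derivative
         (x * t powr (x - 1) * (1 + t) powr (- c) + t powr x * (- c * (1 + t) powr (- c - 1))) * exp (- (z * t))
         + t powr x * (1 + t) powr (- c) * (- z * exp (- (z * t)))) (at t)"
        using t by (auto intro!: derivative_eq_intros)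
      also have "(x * t powr (x - 1) * (1 + t) powr (- c) + t powr x * (- c * (1 + t) powr (- c - 1))) * exp (- (z * t))
         + t powr x * (1 + t) powr (- c) * (- z * exp (- (z * t))) = f t"
        unfolding f_def e by (simp add: algebra_simps)
      finally show ?thesis by (simp add: has_real_derivative_iff_has_vector_derivative)
    qed
    show "isCont f t" if "ereal 0 < ereal t" for t
      using that unfolding f_def by (auto intro!: continuous_intros)
    show "set_integrable lborel (einterval (ereal 0) \<infinity>) f"
      using f by (simp add: einterval_def greaterThan_def)
    have "((\<lambda>t. t powr x * (1 + t) powr (- c) * exp (- (z * t))) \<longlongrightarrow> 0) (at_right 0)"
      using assms by real_asymp
    thus "(((\<lambda>t. t powr x * (1 + t) powr (- c) * exp (- (z * t))) \<circ> real_of_ereal) \<longlongrightarrow> 0) (at_right (ereal 0))"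
      by (simp add: ereal_tendsto_simps)
    have "((\<lambda>t. t powr x * (1 + t) powr (- c) * exp (- (z * t))) \<longlongrightarrow> 0) at_top"
      using assms by real_asymp
    thus "(((\<lambda>t. t powr x * (1 + t) powr (- c) * exp (- (z * t))) \<circ> real_of_ereal) \<longlongrightarrow> 0) (at_left \<infinity>)"
      by (simp add: ereal_tendsto_simps)
  qed simp
  hence "(LINT t:{0<..}|lborel. f t) = 0"
    by (simp only: interval_integral_to_infinity_eq)
  ultimately show ?thesis by simp
qed

text \<open>Differentiation under the integral sign, by dominated convergence of the difference
  quotients.\<close>

lemma tricomi_integral_deriv:
  assumes "x > 0" "c > 0" "z > 0"
  shows "(tricomi_integral x c has_real_derivative - tricomi_integral (x + 1) c z) (at z)"
proof -
  let ?k = "\<lambda>z t. t powr (x - 1) * (1 + t) powr (- c) * exp (- (z * t))"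
  \<comment> \<open>Keeping the parameter above $z/2$ allows one majorant with $e^{-zt/2}$ for all
    difference quotients.\<close>
  have S: "at z = at z within {z/2<..}" 
    using assms by (intro at_within_open[symmetric]) auto
  have int: "set_integrable lborel {0<..} (?k w)" if "w > 0" for w
    using assms that by (intro set_integrable_tricomi) auto
  have quot: "(tricomi_integral x c w - tricomi_integral x c z) / (w - z) =
      (LINT t:{0<..}|lborel. (?k w t - ?k z t) / (w - z))" if "w > 0" for w
    using set_integral_diff(2)[OF int[OF that] int[OF assms(3)]]
    unfolding tricomi_integral_def by simp
  have "((\<lambda>w. LINT t:{0<..}|lborel. (?k w t - ?k z t) / (w - z)) \<longlongrightarrow>
      (LINT t:{0<..}|lborel. - (t powr (x + 1 - 1) * (1 + t) powr (- c) * exp (- (z * t))))) (at z within {z/2<..})"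
  proof (rule tendsto_set_integral_dominated)
    show "set_integrable lborel {0<..} (\<lambda>t. t powr (x + 1 - 1) * (1 + t) powr (- c) * exp (- (z / 2 * t)))"
      using assms by (intro set_integrable_tricomi) auto
    fix t :: real assume "t \<in> {0<..}"
    hence t: "t > 0" by simp
    have tx: "t powr (x + 1 - 1) = t * t powr (x - 1)"
      using powr_mult_base[of t "x - 1"] t by simp
    have "((\<lambda>z. ?k z t) has_real_derivative - (t powr (x + 1 - 1) * (1 + t) powr (- c) * exp (- (z * t)))) (at z)"
      unfolding tx by (auto intro!: derivative_eq_intros)
    thus "((\<lambda>w. (?k w t - ?k z t) / (w - z)) \<longlongrightarrow>
        - (t powr (x + 1 - 1) * (1 + t) powr (- c) * exp (- (z * t)))) (at z within {z/2<..})"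
      unfolding S[symmetric] by (simp add: has_field_derivative_iff)
    fix w assume w: "w \<in> {z/2<..}" "w \<noteq> z"
    \<comment> \<open>From $1 - e^{-s} \<le> s$ with $s = (v-u)t$. It is applied with
      \<open>w\<close> and \<open>z\<close> in either order.\<close>
    have ineq: "\<bar>exp (- (u * t)) - exp (- (v * t))\<bar> \<le> \<bar>u - v\<bar> * (t * exp (- (z / 2 * t)))"
      if "u \<ge> z / 2" "u \<le> v" for u v
    proof -
      have "1 - exp (- ((v - u) * t)) \<le> (v - u) * t"
        using exp_ge_add_one_self[of "- ((v - u) * t)"] by linarith
      hence "exp (- (u * t)) * (1 - exp (- ((v - u) * t))) \<le> exp (- (u * t)) * ((v - u) * t)"
        by (intro mult_left_mono) auto
      also have "\<dots> \<le> exp (- (z / 2 * t)) * ((v - u) * t)"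
        using that t by (intro mult_right_mono) auto
      also have "exp (- (u * t)) * (1 - exp (- ((v - u) * t))) = exp (- (u * t)) - exp (- (v * t))"
        by (simp add: right_diff_distrib exp_add[symmetric] left_diff_distrib)
      finally have "exp (- (u * t)) - exp (- (v * t)) \<le> \<bar>u - v\<bar> * (t * exp (- (z / 2 * t)))"
        using that by (simp add: mult_ac)
      moreover have "exp (- (v * t)) \<le> exp (- (u * t))"
        using that t by simp
      ultimately show ?thesis by simp
    qed
    have "\<bar>exp (- (w * t)) - exp (- (z * t))\<bar> \<le> \<bar>w - z\<bar> * (t * exp (- (z / 2 * t)))"
      using ineq[of w z] ineq[of z w] w assms by (cases "w \<le> z") (auto simp: abs_minus_commute)
    hence "\<bar>exp (- (w * t)) - exp (- (z * t))\<bar> / \<bar>w - z\<bar> \<le> t * exp (- (z / 2 * t))"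
      using w by (simp add: divide_le_eq mult.commute)
    hence "t powr (x - 1) * (1 + t) powr (- c) * (\<bar>exp (- (w * t)) - exp (- (z * t))\<bar> / \<bar>w - z\<bar>) \<le>
        t powr (x - 1) * (1 + t) powr (- c) * (t * exp (- (z / 2 * t)))"
      by (intro mult_left_mono) auto
    hence le: "\<bar>t powr (x - 1) * (1 + t) powr (- c) * ((exp (- (w * t)) - exp (- (z * t))) / (w - z))\<bar> \<le>
        t powr (x - 1) * (1 + t) powr (- c) * (t * exp (- (z / 2 * t)))"
      by (simp add: abs_mult)
    have eq: "(?k w t - ?k z t) / (w - z) =
        t powr (x - 1) * (1 + t) powr (- c) * ((exp (- (w * t)) - exp (- (z * t))) / (w - z))"
      by (simp add: right_diff_distrib)
    show "\<bar>(?k w t - ?k z t) / (w - z)\<bar> \<le>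
        t powr (x + 1 - 1) * (1 + t) powr (- c) * exp (- (z / 2 * t))"
      using le unfolding tx eq by (simp only: mult_ac)
  qed auto
  hence "((\<lambda>w. LINT t:{0<..}|lborel. (?k w t - ?k z t) / (w - z)) \<longlongrightarrow> - tricomi_integral (x + 1) c z)
      (at z within {z/2<..})"
    unfolding tricomi_integral_def by (simp add: set_lebesgue_integral_def)
  hence "((\<lambda>w. (tricomi_integral x c w - tricomi_integral x c z) / (w - z)) \<longlongrightarrow> - tricomi_integral (x + 1) c z)
      (at z within {z/2<..})"
  proof (rule Lim_transform_eventually)
    show "\<forall>\<^sub>F w in at z within {z/2<..}. (LINT t:{0<..}|lborel. (?k w t - ?k z t) / (w - z)) =
        (tricomi_integral x c w - tricomi_integral x c z) / (w - z)"
      unfolding eventually_at_filter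
      by (intro always_eventually allI impI quot[symmetric]) (use assms in simp)
  qed
  thus ?thesis by (simp add: has_field_derivative_iff S[symmetric])
qed

section \<open>Behaviour of the integral as $z$ tends to 0\<close>

lemma Beta_integral_second_kind:
  fixes a b :: real
  assumes "a > 0" "b > 0"
  shows "set_integrable lborel {0<..} (\<lambda>t. t powr (a - 1) * (1 + t) powr (- (a + b)))"
    and "(LINT t:{0<..}|lborel. t powr (a - 1) * (1 + t) powr (- (a + b))) = Beta a b"
proof -
  define f where "f t = t powr (a - 1) * (1 + t) powr (- (a + b))" for t :: real
  \<comment> \<open>The substitution $t = u/(1-u)$ has derivative $(1-u)^{-2}$, and the exponents of
    $1-u$ add up to $-(a-1) + (a+b) - 2 = b-1$. This is the classical Beta integrand.\<close>
  define h where "h u = u powr (a - 1) * (1 - u) powr (b - 1)" for u :: real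
  have eq: "f (u / (1 - u)) * (1 / (1 - u)\<^sup>2) = h u" if "0 < u" "u < 1" for u
  proof -
    define v where "v = 1 - u"
    have v: "v > 0" "1 + u / v = 1 / v" using that by (simp_all add: v_def field_simps)
    have "(u / v) powr (a - 1) = u powr (a - 1) * v powr - (a - 1)"
      using v that by (simp only: powr_divide powr_minus) (simp add: divide_inverse)
    moreover have "(1 / v) powr - (a + b) = v powr (a + b)"
      using v by (simp only: powr_minus) (simp add: powr_divide)
    moreover have "1 / v\<^sup>2 = v powr - 2"
      using v by (simp add: powr_minus_divide)
    ultimately have "f (u / (1 - u)) * (1 / (1 - u)\<^sup>2) =
        u powr (a - 1) * ((1 - u) powr - (a - 1) * (1 - u) powr (a + b) * (1 - u) powr - 2)"
      unfolding f_def v_def[symmetric] v(2) by simp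
    also have "(1 - u) powr - (a - 1) * (1 - u) powr (a + b) * (1 - u) powr - 2 = (1 - u) powr (b - 1)"
      by (simp flip: powr_add)
    finally show ?thesis by (simp add: h_def)
  qed
  have E01: "einterval (ereal 0) (ereal 1) = {0<..<1}" by (auto simp: einterval_def)
  have E0: "einterval (ereal 0) \<infinity> = {0<..}" by (auto simp: einterval_def)
  have h: "set_integrable lborel {0<..<1} h"
    unfolding h_def by (rule set_integrable_subset[OF integrable_Beta[OF assms]]) auto
  have s1: "((\<lambda>u. u / (1 - u)) has_real_derivative 1 / (1 - u)\<^sup>2) (at u)"
    if "ereal 0 < ereal u" "ereal u < ereal 1" for u
    using that by (auto intro!: derivative_eq_intros simp: power2_eq_square field_simps)
  have s2: "isCont f (u / (1 - u))" if "ereal 0 < ereal u" "ereal u < ereal 1" for u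
  proof -
    have "u / (1 - u) > 0" using that by simp
    thus ?thesis unfolding f_def by (auto intro!: continuous_intros)
  qed
  have s3: "isCont (\<lambda>u. 1 / (1 - u)\<^sup>2) u" if "ereal 0 < ereal u" "ereal u < ereal 1" for u
    using that by (auto intro!: continuous_intros)
  have s4: "0 \<le> f (u / (1 - u))" if "ereal 0 < ereal u" "ereal u < ereal 1" for u
    by (simp add: f_def)
  have s5: "0 \<le> 1 / (1 - u)\<^sup>2" if "ereal 0 \<le> ereal u" "ereal u \<le> ereal 1" for u
    by simp
  have "((\<lambda>u::real. u / (1 - u)) \<longlongrightarrow> 0) (at_right 0)" by real_asymp
  hence s6: "((ereal \<circ> (\<lambda>u. u / (1 - u)) \<circ> real_of_ereal) \<longlongrightarrow> ereal 0) (at_right (ereal 0))"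
    by (simp add: ereal_tendsto_simps)
  have "filterlim (\<lambda>u::real. u / (1 - u)) at_top (at_left 1)" by real_asymp
  hence s7: "((ereal \<circ> (\<lambda>u. u / (1 - u)) \<circ> real_of_ereal) \<longlongrightarrow> \<infinity>) (at_left (ereal 1))"
    by (simp add: ereal_tendsto_simps)
  have s8: "set_integrable lborel (einterval (ereal 0) (ereal 1)) (\<lambda>u. f (u / (1 - u)) * (1 / (1 - u)\<^sup>2))"
    unfolding E01 using h by (subst set_integrable_cong[OF refl refl eq]) auto
  note subst = interval_integral_substitution_nonneg[where g = "\<lambda>u. u / (1 - u)" and f = f, OF _ s1 s2 s3 s4 s5 s6 s7 s8]
  show "set_integrable lborel {0<..} f"
    using subst(1) unfolding E0 by simp
  have "(LINT t:{0<..}|lborel. f t) = (LBINT u=ereal 0..ereal 1. f (u / (1 - u)) * (1 / (1 - u)\<^sup>2))"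
    using subst(2) by (simp add: interval_integral_to_infinity_eq)
  also have "\<dots> = (LINT u:{0<..<1}|lborel. h u)"
    by (simp add: interval_lebesgue_integral_def E01) (intro set_lebesgue_integral_cong, auto simp: eq[simplified])
  also have "\<dots> = integral {0<..<1} h"
    using set_borel_integral_eq_integral(2)[OF h] .
  also have "\<dots> = Beta a b"
    using has_integral_Beta_real[OF assms] unfolding h_def
    by (simp add: integral_open_interval_real[symmetric] integral_unique has_integral_Icc_iff_Ioo)
  finally show "(LINT t:{0<..}|lborel. f t) = Beta a b" .
qed

text \<open>Dropping the exponential gives both the limit and the majorant; it is integrable because
  $c > x$, that is $y < 1$.\<close>

lemma tricomi_integral_tendsto_0:
  assumes "x > 0" "c > x"
  shows "(tricomi_integral x c \<longlongrightarrow> Beta x (c - x)) (at_right 0)"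
proof -
  have "((\<lambda>z. LINT t:{0<..}|lborel. t powr (x - 1) * (1 + t) powr (- c) * exp (- (z * t))) \<longlongrightarrow>
      (LINT t:{0<..}|lborel. t powr (x - 1) * (1 + t) powr (- c))) (at_right 0)"
  proof (rule tendsto_set_integral_dominated)
    show "set_integrable lborel {0<..} (\<lambda>t. t powr (x - 1) * (1 + t) powr (- c))"
      using Beta_integral_second_kind(1)[of x "c - x"] assms by simp
    show "((\<lambda>z. t powr (x - 1) * (1 + t) powr (- c) * exp (- (z * t))) \<longlongrightarrow>
        t powr (x - 1) * (1 + t) powr (- c)) (at_right 0)" for t :: real
      by (auto intro!: tendsto_eq_intros)
    show "\<bar>t powr (x - 1) * (1 + t) powr (- c) * exp (- (z * t))\<bar> \<le> t powr (x - 1) * (1 + t) powr (- c)"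
      if "z \<in> {0<..}" "t \<in> {0<..}" for z t :: real
      using that by (auto simp: abs_mult intro!: mult_left_le)
  qed auto
  thus ?thesis
    using Beta_integral_second_kind(2)[of x "c - x"] assms unfolding tricomi_integral_def by simp
qed

text \<open>Substitution $s = zt$; the prefactor cancels all the powers of \<open>z\<close> that
  this produces, and \<open>z\<close> remains only in $z+s$.\<close>

lemma tricomi_integral_scale:
  assumes "z > 0"
  shows "z powr (1 + x - c) * tricomi_integral (x + 1) c z =
    (LINT s:{0<..}|lborel. s powr x * (z + s) powr (- c) * exp (- s))"
proof -
  have pow: "z powr (1 + x - c) * inverse z * ((s / z) powr x * (1 + s / z) powr (- c)) =
      s powr x * (z + s) powr (- c)" if "s > 0" for s
  proof -
    have "1 + s / z = (z + s) / z" using assms by (simp add: field_simps)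
    hence "z powr (1 + x - c) * inverse z * ((s / z) powr x * (1 + s / z) powr (- c)) =
        (z powr (1 + x - c) * z powr (- 1) * z powr (- x) * z powr c) * (s powr x * (z + s) powr (- c))"
      using assms that by (simp add: powr_divide powr_minus_divide divide_simps)
    also have "z powr (1 + x - c) * z powr (- 1) * z powr (- x) * z powr c = 1"
      using assms by (simp flip: powr_add)
    finally show ?thesis by simp
  qed
  let ?f = "\<lambda>t. indicator {0<..} t *\<^sub>R (t powr (x + 1 - 1) * (1 + t) powr (- c) * exp (- (z * t)))"
  have "z powr (1 + x - c) * tricomi_integral (x + 1) c z =
      z powr (1 + x - c) * (inverse z * (\<integral>s. ?f (s / z) \<partial>lborel))"
    using lborel_integral_real_affine[of "inverse z" ?f 0] assms
    unfolding tricomi_integral_def set_lebesgue_integral_def by (simp add: field_simps)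
  also have "\<dots> = (\<integral>s. z powr (1 + x - c) * (inverse z * ?f (s / z)) \<partial>lborel)"
    by simp
  also have "\<dots> = (LINT s:{0<..}|lborel. s powr x * (z + s) powr (- c) * exp (- s))"
    unfolding set_lebesgue_integral_def
  proof (intro Bochner_Integration.integral_cong refl)
    fix s :: real
    show "z powr (1 + x - c) * (inverse z * ?f (s / z)) =
        indicator {0<..} s *\<^sub>R (s powr x * (z + s) powr (- c) * exp (- s))"
    proof (cases "s > 0")
      case True
      thus ?thesis using assms by (simp add: pow[symmetric])
    qed (use assms in \<open>auto simp: indicator_def field_simps\<close>)
  qed
  finally show ?thesis .
qed

text \<open>In the scaled form, $(z+s)^{-c}$ increases to $s^{-c}$ as \<open>z\<close> decreases to
  0. The limit is the integrand of \<open>Gamma (1 + x - c)\<close>, which is its own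
  majorant.\<close>

lemma tricomi_integral_scaled_tendsto_0:
  assumes "c > 0" "1 + x - c > 0"
  shows "((\<lambda>z. z powr (1 + x - c) * tricomi_integral (x + 1) c z) \<longlongrightarrow> Gamma (1 + x - c)) (at_right 0)"
proof -
  have pow: "s powr (1 + x - c - 1) = s powr x * s powr (- c)" if "s > 0" for s
    using that by (simp flip: powr_add)
  have "((\<lambda>z. LINT s:{0<..}|lborel. s powr x * (z + s) powr (- c) * exp (- s)) \<longlongrightarrow>
      (LINT s:{0<..}|lborel. s powr (1 + x - c - 1) * exp (- s))) (at_right 0)"
  proof (rule tendsto_set_integral_dominated)
    show "set_integrable lborel {0<..} (\<lambda>s. s powr (1 + x - c - 1) * exp (- s))"
      using set_integrable_powr_exp[OF assms(2) zero_less_one] by simp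
    show "((\<lambda>z. s powr x * (z + s) powr (- c) * exp (- s)) \<longlongrightarrow> s powr (1 + x - c - 1) * exp (- s)) (at_right 0)"
      if "s \<in> {0<..}" for s :: real
      unfolding pow[of s, OF that[simplified]] using that by (auto intro!: tendsto_eq_intros)
    show "\<bar>s powr x * (z + s) powr (- c) * exp (- s)\<bar> \<le> s powr (1 + x - c - 1) * exp (- s)"
      if "z \<in> {0<..}" "s \<in> {0<..}" for z s :: real
    proof -
      have "(z + s) powr (- c) \<le> s powr (- c)"
        using that assms by (intro powr_mono2') auto
      hence "s powr x * (z + s) powr (- c) * exp (- s) \<le> s powr x * s powr (- c) * exp (- s)"
        by (intro mult_right_mono mult_left_mono) auto
      thus ?thesis using that by (simp only: pow[of s, OF that(2)[simplified]] abs_mult) simp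
    qed
  qed auto
  hence "((\<lambda>z. LINT s:{0<..}|lborel. s powr x * (z + s) powr (- c) * exp (- s)) \<longlongrightarrow> Gamma (1 + x - c)) (at_right 0)"
    using Gamma_eq_lborel_integral[OF assms(2)] by simp
  thus ?thesis
    by (rule Lim_transform_eventually)
      (auto simp: eventually_at_filter tricomi_integral_scale)
qed

section \<open>Identification of the Tricomi function with the integral\<close>

lemma rGamma_reflection_real: "rGamma y * rGamma (1 - y) = sin (pi * y) / (pi :: real)"
proof -
  have "of_real (rGamma y * rGamma (1 - y)) = rGamma (of_real y) * rGamma (1 - of_real y :: complex)"
    using rGamma_complex_of_real[of y] rGamma_complex_of_real[of "1 - y"] by simp
  also have "\<dots> = of_real (sin (pi * y) / pi)"
    unfolding rGamma_reflection_complex by (simp flip: sin_of_real)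
  finally show ?thesis unfolding of_real_eq_iff .
qed

lemma tricomi_nonint_eq_integral:
  assumes "x > 0" "c > 0" "z > 0" "x - c \<notin> \<int>"
  shows "Gamma x * tricomi_nonint x (1 + x - c) z = tricomi_integral x c z"
proof -
  \<comment> \<open>The coefficient of \<open>kummer_part'\<close> is written as subtraction of a
    negative multiple so that \<open>tricomi_family_diff_cmult\<close> applies twice.\<close>
  define D where "D x c z = tricomi_integral x c z - pi * kummer_part x c z - (- pi) * kummer_part' x c z"
    for x c z
  have fam: "tricomi_family tricomi_integral"
    by unfold_locales
      (auto intro: tricomi_integral_split tricomi_integral_parts tricomi_integral_deriv)
  have D: "tricomi_family D"
    unfolding D_def[abs_def]
    by (intro tricomi_family_diff_cmult fam tricomi_family_kummer_part tricomi_family_kummer_part')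
  interpret D: tricomi_family D by (rule D)
  have D0: "D x c z = 0"
  proof (rule D.eq_0_if_eq_0_on_strip[OF _ assms(3,1,2,4)])
    fix x c :: real assume *: "x > 0" "c > 0" "0 < 1 + x - c" "1 + x - c < 1"
    define y where "y = 1 + x - c"
    have y: "0 < y" "y < 1" "1 - y = c - x" "x + (1 - y) = c" "1 + c - x = 2 - y" using * by (simp_all add: y_def)
    have "pi * y < pi * 1" by (rule mult_strict_left_mono) (use y in auto)
    hence s: "sin (pi * y) > 0" using y by (intro sin_gt_zero) auto
    have G: "Gamma x > 0" "Gamma c > 0" "Gamma y > 0" "Gamma (1 - y) > 0"
      using * y by (auto intro!: Gamma_real_pos)
    \<comment> \<open>Reflection in two forms: one makes the limit of \<open>D x c\<close> vanish,
      the other that of the scaled \<open>D (x + 1) c\<close>.\<close>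
    have refl: "pi * (rGamma y / sin (pi * y)) = Gamma (1 - y)" "pi * (rGamma (1 - y) / sin (pi * y)) = Gamma y"
      using rGamma_reflection_real[of y] s G by (auto simp: rGamma_inverse_Gamma field_simps)
    have sc: "(reg_kummer p r \<longlongrightarrow> rGamma r) (at_right 0)" for p r
      using continuous_reg_kummer[of 0 p r]
      by (simp add: isCont_def filterlim_at_split reg_kummer_0)
    have lim: "(kummer_part x c \<longlongrightarrow> Gamma x / Gamma c * rGamma (1 + x - c) / sin (pi * (1 + x - c))) (at_right 0)"
      if "sin (pi * (1 + x - c)) \<noteq> 0" for x c
      unfolding kummer_part_def[abs_def] using that by (intro tendsto_intros sc)
    have s': "sin (pi * (1 + (x + 1) - c)) = - sin (pi * y)"
      using sin_pi_add1[of y] by (simp add: y_def add_ac add_diff_eq)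
    have powr0: "((\<lambda>z. z powr e) \<longlongrightarrow> 0) (at_right 0)" if "e > 0" for e :: real
      using that by real_asymp
    show "D x c z = 0"
    proof (rule tricomi_family_eq_0[OF D tricomi_family_kummer_part *])
      show "kummer_part x c z > 0" if "z > 0" for z
        unfolding kummer_part_def y_def[symmetric]
        using that * y s G reg_kummer_pos[of x y z] by simp
      show "(kummer_part x c \<longlongrightarrow> Gamma x / Gamma c * rGamma y / sin (pi * y)) (at_right 0)"
        using lim[of x c] s by (simp add: y_def)
      show "0 < Gamma x / Gamma c * rGamma y / sin (pi * y)"
        using s G by (simp add: rGamma_inverse_Gamma)
      show lim': "(kummer_part (x + 1) c \<longlongrightarrow>
          Gamma (x + 1) / Gamma c * rGamma (1 + (x + 1) - c) / sin (pi * (1 + (x + 1) - c))) (at_right 0)"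
        using s s' by (intro lim) auto
      have k': "(kummer_part' x c \<longlongrightarrow> 0 * rGamma (1 + c - x) / sin (pi * (1 + x - c))) (at_right 0)"
        unfolding kummer_part'_def[abs_def] using * s y_def by (intro tendsto_intros sc powr0) auto
      have "(D x c \<longlongrightarrow> Beta x (c - x) - pi * (Gamma x / Gamma c * rGamma y / sin (pi * y)) - (- pi) * 0) (at_right 0)"
        unfolding D_def[abs_def]
        using lim[of x c] s k' * by (intro tendsto_intros tricomi_integral_tendsto_0) (auto simp: y_def)
      moreover have "Beta x (c - x) = pi * (Gamma x / Gamma c * rGamma y / sin (pi * y))"
      proof -
        have "pi * (Gamma x / Gamma c * rGamma y / sin (pi * y)) =
            Gamma x / Gamma c * (pi * (rGamma y / sin (pi * y)))" by simp
        also have "\<dots> = Gamma x * Gamma (1 - y) / Gamma c" unfolding refl by simp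
        finally show ?thesis by (simp add: Beta_def y)
      qed
      ultimately show "(D x c \<longlongrightarrow> 0) (at_right 0)" by simp
      show "((\<lambda>z. z powr (1 + x - c) * D (x + 1) c z) \<longlongrightarrow> 0) (at_right 0)"
      proof -
        have "((\<lambda>z. z powr y * kummer_part (x + 1) c z) \<longlongrightarrow> 0) (at_right 0)"
          using tendsto_mult[OF powr0[OF y(1)] lim'] by simp
        moreover have "((\<lambda>z. z powr y * tricomi_integral (x + 1) c z) \<longlongrightarrow> Gamma y) (at_right 0)"
          using tricomi_integral_scaled_tendsto_0[of c x] * by (simp add: y_def)
        \<comment> \<open>The scaling cancels the power of \<open>z\<close> in
          \<open>kummer_part'\<close> exactly, so this term has a nonzero limit, to be matched with
          \<open>Gamma y\<close>.\<close>
        moreover have "((\<lambda>z. z powr y * kummer_part' (x + 1) c z) \<longlongrightarrow>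
            rGamma (1 - y) / (- sin (pi * y))) (at_right 0)"
        proof (rule Lim_transform_eventually)
          show "((\<lambda>z. reg_kummer c (1 - y) z / (- sin (pi * y))) \<longlongrightarrow>
              rGamma (1 - y) / (- sin (pi * y))) (at_right 0)"
            using s by (intro tendsto_intros sc) auto
          have "reg_kummer c (1 - y) z / (- sin (pi * y)) = z powr y * kummer_part' (x + 1) c z" if "z > 0" for z
          proof -
            have "z powr y * z powr (c - (x + 1)) = 1"
              using that by (simp add: y_def flip: powr_add)
            moreover have "1 + c - (x + 1) = 1 - y" by (simp add: y_def)
            ultimately show ?thesis unfolding kummer_part'_def s' by simp
          qed
          thus "\<forall>\<^sub>F z in at_right 0. reg_kummer c (1 - y) z / (- sin (pi * y)) = z powr y * kummer_part' (x + 1) c z"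
            by (auto simp: eventually_at_filter)
        qed
        ultimately have "((\<lambda>z. z powr y * tricomi_integral (x + 1) c z - pi * (z powr y * kummer_part (x + 1) c z)
            - (- pi) * (z powr y * kummer_part' (x + 1) c z)) \<longlongrightarrow>
            Gamma y - pi * 0 - (- pi) * (rGamma (1 - y) / (- sin (pi * y)))) (at_right 0)"
          by (intro tendsto_intros)
        also have "Gamma y - pi * 0 - (- pi) * (rGamma (1 - y) / (- sin (pi * y))) = 0"
          using refl(2) by simp
        finally show ?thesis
          unfolding D_def y_def by (simp add: algebra_simps)
      qed
    qed (use assms in simp)
  qed
  define y where "y = 1 + x - c"
  have yn: "y \<notin> \<int>"
  proof
    assume "y \<in> \<int>"
    hence "y - 1 \<in> \<int>" by (rule Ints_diff) simp
    with assms show False by (simp add: y_def)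
  qed
  have "2 - y \<notin> \<int>"
  proof
    assume "2 - y \<in> \<int>"
    hence "2 - (2 - y) \<in> \<int>" by (intro Ints_diff) simp_all
    with yn show False by simp
  qed
  \<comment> \<open>Away from the poles \<open>Gamma\<close> does not take its default value 0, so
    the factors gained in passing to \<open>reg_kummer\<close> cancel against the denominators of
    \<Psi>.\<close>
  with yn have "y \<notin> \<int>\<^sub>\<le>\<^sub>0" "2 - y \<notin> \<int>\<^sub>\<le>\<^sub>0"
    using nonpos_Ints_subset_Ints by blast+
  hence M: "kummer_M x y z = Gamma y * reg_kummer x y z" "kummer_M c (2 - y) z = Gamma (2 - y) * reg_kummer c (2 - y) z"
    "Gamma y \<noteq> 0" "Gamma (2 - y) \<noteq> 0"
    by (auto simp: kummer_M_eq_reg_kummer Gamma_eq_zero_iff)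
  have c: "1 + x - y = c" "1 - y = c - x" "1 + c - x = 2 - y" by (simp_all add: y_def)
  have "Gamma x > 0" using assms by simp
  hence "Gamma x * tricomi_nonint x y z = pi * kummer_part x c z - pi * kummer_part' x c z"
    unfolding tricomi_nonint_def kummer_part_def kummer_part'_def y_def[symmetric] c M(1,2)
    using M(3,4) by (simp add: right_diff_distrib diff_divide_distrib mult_ac)
  also have "\<dots> = tricomi_integral x c z" using D0 by (simp add: D_def)
  finally show ?thesis by (simp add: y_def)
qed

text \<open>Near \<open>y\<close> the exponent \<open>1 + x - y'\<close> stays positive, so the
  integrand with exponent 0 dominates.\<close>

lemma tricomi_integral_tendsto_c:
  assumes "x > 0" "z > 0" "1 + x - y > 0"
  shows "((\<lambda>y'. tricomi_integral x (1 + x - y') z) \<longlongrightarrow> tricomi_integral x (1 + x - y) z) (at y)"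
proof -
  have "((\<lambda>y'. LINT t:{0<..}|lborel. t powr (x - 1) * (1 + t) powr (- (1 + x - y')) * exp (- (z * t))) \<longlongrightarrow>
      (LINT t:{0<..}|lborel. t powr (x - 1) * (1 + t) powr (- (1 + x - y)) * exp (- (z * t)))) (at y within {..<1 + x})"
  proof (rule tendsto_set_integral_dominated)
    show "set_integrable lborel {0<..} (\<lambda>t. t powr (x - 1) * (1 + t) powr (- 0) * exp (- (z * t)))"
      using assms by (intro set_integrable_tricomi) auto
    show "((\<lambda>y'. t powr (x - 1) * (1 + t) powr (- (1 + x - y')) * exp (- (z * t))) \<longlongrightarrow>
       t powr (x - 1) * (1 + t) powr (- (1 + x - y)) * exp (- (z * t))) (at y within {..<1 + x})"
      if "t \<in> {0<..}" for t
      using that by (intro tendsto_intros) auto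
    show "\<bar>t powr (x - 1) * (1 + t) powr (- (1 + x - w)) * exp (- (z * t))\<bar> \<le>
        t powr (x - 1) * (1 + t) powr (- 0) * exp (- (z * t))"
      if "w \<in> {..<1 + x}" "t \<in> {0<..}" for w t
    proof -
      have "t powr (x - 1) * (1 + t) powr (- (1 + x - w)) * exp (- (z * t)) \<le>
        t powr (x - 1) * (1 + t) powr (- 0) * exp (- (z * t))"
        using that by (intro mult_right_mono mult_left_mono powr_mono) auto
      thus ?thesis by (simp add: abs_mult)
    qed
  qed auto
  moreover have "at y within {..<1 + x} = at y"
    using assms by (intro at_within_open) auto
  ultimately show ?thesis by (simp add: tricomi_integral_def)
qed

lemma tricomi_Psi_eq_integral:
  assumes "x > 0" "z > 0" "1 + x - y > 0"
  shows "Gamma x * tricomi_Psi x y z = tricomi_integral x (1 + x - y) z"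
proof -
  have G: "Gamma x \<noteq> 0" using Gamma_real_pos[OF assms(1)] by linarith
  have nonint: "tricomi_nonint x y' z = tricomi_integral x (1 + x - y') z / Gamma x"
    if "y' \<notin> \<int>" "1 + x - y' > 0" for y'
  proof -
    have "x - (1 + x - y') \<notin> \<int>"
    proof
      assume "x - (1 + x - y') \<in> \<int>"
      hence "x - (1 + x - y') + 1 \<in> \<int>" by (rule Ints_add) simp
      with that show False by simp
    qed
    from tricomi_nonint_eq_integral[OF assms(1) that(2) assms(2) this]
    show ?thesis using G by (simp add: field_simps)
  qed
  show ?thesis
  proof (cases "y \<in> \<int>")
    case False
    thus ?thesis using nonint[of y] assms G by (simp add: tricomi_Psi_def)
  next
    case True
    have "((\<lambda>y'. tricomi_nonint x y' z) \<longlongrightarrow> tricomi_integral x (1 + x - y) z / Gamma x) (at y)"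
    proof (rule Lim_transform_eventually)
      show "((\<lambda>y'. tricomi_integral x (1 + x - y') z / Gamma x) \<longlongrightarrow>
          tricomi_integral x (1 + x - y) z / Gamma x) (at y)"
        using G assms by (intro tendsto_intros tricomi_integral_tendsto_c) auto
      \<comment> \<open>Radius 1 excludes every other integer, and the bound \<open>1 + x\<close>
        keeps the second parameter of the integral positive.\<close>
      have "eventually (\<lambda>y'. y' \<in> {y - 1<..<y + 1} \<inter> {..<1 + x}) (nhds y)"
        using assms by (intro eventually_nhds_in_open) auto
      hence "eventually (\<lambda>y'. y' \<in> {y - 1<..<y + 1} \<inter> {..<1 + x} - {y}) (at y)"
        by (auto simp: eventually_at_filter elim: eventually_mono)
      thus "\<forall>\<^sub>F y' in at y. tricomi_integral x (1 + x - y') z / Gamma x = tricomi_nonint x y' z"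
      proof (rule eventually_mono)
        fix y' assume y': "y' \<in> {y - 1<..<y + 1} \<inter> {..<1 + x} - {y}"
        from True obtain m where m: "y = of_int m" by (auto elim: Ints_cases)
        have "y' \<notin> \<int>"
        proof
          assume "y' \<in> \<int>"
          then obtain n where n: "y' = of_int n" by (auto elim: Ints_cases)
          have "real_of_int (m - 1) < of_int n" "real_of_int n < of_int (m + 1)" "n \<noteq> m"
            using y' unfolding m n by auto
          thus False unfolding of_int_less_iff by simp
        qed
        thus "tricomi_integral x (1 + x - y') z / Gamma x = tricomi_nonint x y' z"
          using y' by (intro nonint[symmetric]) auto
      qed
    qed
    hence "tricomi_Psi x y z = tricomi_integral x (1 + x - y) z / Gamma x"
      using True by (simp add: tricomi_Psi_def tendsto_Lim)
    thus ?thesis using G by simp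
  qed
qed

section \<open>The quotient distribution\<close>

text \<open>For fixed $y > 0$ substitute $x = \<theta> y$ with Jacobian $y$, then exchange the
  integrals by Tonelli. As \<open>g\<close> vanishes on $y \<le> 0$, neither the sign of the
  Jacobian nor division by 0 matters.\<close>

lemma (in prob_space) distributed_divide:
  fixes X Y :: "'a \<Rightarrow> real"
  assumes X: "distributed M lborel X f" and Y: "distributed M lborel Y g"
    and ind: "indep_var borel X borel Y" and g0: "\<And>y. y \<le> 0 \<Longrightarrow> g y = 0"
  shows "distributed M lborel (\<lambda>\<omega>. X \<omega> / Y \<omega>) (\<lambda>\<theta>. \<integral>\<^sup>+y. f (\<theta> * y) * g y * ennreal y \<partial>lborel)"
proof -
  have [measurable]: "f \<in> borel_measurable borel" "g \<in> borel_measurable borel"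
    using distributed_borel_measurable[OF X] distributed_borel_measurable[OF Y] by auto
  have [measurable]: "X \<in> borel_measurable M" "Y \<in> borel_measurable M"
    using distributed_measurable[OF X] distributed_measurable[OF Y] by auto
  \<comment> \<open>Composing with the identity exchanges \<open>borel\<close> for
    \<open>lborel\<close>, which has the same measurable sets.\<close>
  have "indep_var lborel (id \<circ> X) lborel (id \<circ> Y)"
    by (rule indep_var_compose[OF ind]) auto
  hence joint: "distributed M (lborel \<Otimes>\<^sub>M lborel) (\<lambda>\<omega>. (X \<omega>, Y \<omega>)) (\<lambda>(x, y). f x * g y)"
    by (intro distributed_joint_indep lborel.sigma_finite_measure_axioms X Y) simp_all
  define h where "h \<theta> = (\<integral>\<^sup>+y. f (\<theta> * y) * g y * ennreal y \<partial>lborel)" for \<theta> :: real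
  have [measurable]: "h \<in> borel_measurable borel"
    unfolding h_def[abs_def] by measurable
  have "distr M lborel (\<lambda>\<omega>. X \<omega> / Y \<omega>) = density lborel h"
  proof (rule measure_eqI)
    fix A assume "A \<in> sets (distr M lborel (\<lambda>\<omega>. X \<omega> / Y \<omega>))"
    hence A[measurable]: "A \<in> sets borel" by simp
    have "emeasure (distr M lborel (\<lambda>\<omega>. X \<omega> / Y \<omega>)) A = (\<integral>\<^sup>+x. indicator A x \<partial>distr M lborel (\<lambda>\<omega>. X \<omega> / Y \<omega>))"
      by simp
    also have "\<dots> = (\<integral>\<^sup>+\<omega>. indicator A (X \<omega> / Y \<omega>) \<partial>M)"
      by (subst nn_integral_distr) simp_all
    also have "\<dots> = (\<integral>\<^sup>+p. (case p of (x, y) \<Rightarrow> f x * g y) * indicator A (fst p / snd p) \<partial>(lborel \<Otimes>\<^sub>M lborel))"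
      using distributed_nn_integral[OF joint, of "\<lambda>p. indicator A (fst p / snd p)"] by simp
    also have "\<dots> = (\<integral>\<^sup>+y. (\<integral>\<^sup>+x. f x * g y * indicator A (x / y) \<partial>lborel) \<partial>lborel)"
      by (subst lborel_pair.nn_integral_snd[symmetric]) simp_all
    also have "\<dots> = (\<integral>\<^sup>+y. (\<integral>\<^sup>+\<theta>. f (\<theta> * y) * g y * ennreal y * indicator A \<theta> \<partial>lborel) \<partial>lborel)"
    proof (rule nn_integral_cong)
      fix y :: real
      show "(\<integral>\<^sup>+x. f x * g y * indicator A (x / y) \<partial>lborel) =
          (\<integral>\<^sup>+\<theta>. f (\<theta> * y) * g y * ennreal y * indicator A \<theta> \<partial>lborel)"
      proof (cases "y > 0")
        case True
        have "(\<integral>\<^sup>+x. f x * g y * indicator A (x / y) \<partial>lborel) =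
            ennreal y * (\<integral>\<^sup>+\<theta>. f (y * \<theta>) * g y * indicator A \<theta> \<partial>lborel)"
          using True by (subst nn_integral_real_affine[of _ y 0]) simp_all
        also have "\<dots> = (\<integral>\<^sup>+\<theta>. f (\<theta> * y) * g y * ennreal y * indicator A \<theta> \<partial>lborel)"
          by (subst nn_integral_cmult[symmetric]) (simp_all add: mult_ac)
        finally show ?thesis .
      qed (simp add: g0)
    qed
    also have "\<dots> = (\<integral>\<^sup>+\<theta>. (\<integral>\<^sup>+y. f (\<theta> * y) * g y * ennreal y * indicator A \<theta> \<partial>lborel) \<partial>lborel)"
      by (rule lborel_pair.Fubini') measurable
    also have "\<dots> = (\<integral>\<^sup>+\<theta>. h \<theta> * indicator A \<theta> \<partial>lborel)"
      unfolding h_def by (subst nn_integral_multc) simp_all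
    also have "\<dots> = emeasure (density lborel h) A"
      by (simp add: emeasure_density)
    finally show "emeasure (distr M lborel (\<lambda>\<omega>. X \<omega> / Y \<omega>)) A = emeasure (density lborel h) A" .
  qed simp
  thus ?thesis
    by (simp add: distributed_def h_def[symmetric])
qed

lemma phi_pos: "q > 0 \<Longrightarrow> phi q > 0"
  by (simp add: phi_def)

text \<open>Under $y = p t^{1/q}$ the factors $(y/p)^{aq-1}$, $y$ and $dy$ contribute the exponents
  $a - 1/q$, $1/q$ and $1/q - 1$ of $t$. Their sum is $x - 1$ for $x = a + 1/q$.\<close>

lemma nn_integral_quotient_density:
  fixes q a b \<xi> \<theta> :: real
  assumes q: "q > 0" and a: "a > 0" and b: "b > 0" and \<xi>: "\<xi> > 0"
  shows "(\<integral>\<^sup>+y. ennreal (GG_density (\<xi> powr (1 / q)) 1 q (\<theta> * y)) * ennreal (GB2_density q (phi q) a b y) * ennreal y \<partial>lborel)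
    = ennreal (Gambel_density q a b \<xi> \<theta>)"
proof (cases "\<theta> > 0")
  case False
  \<comment> \<open>For $y > 0$ the first density has a nonpositive argument; for $y \<le> 0$ the
    factor \<open>ennreal y\<close> is 0.\<close>
  have zero: "ennreal (GG_density (\<xi> powr (1 / q)) 1 q (\<theta> * y)) * ennreal (GB2_density q (phi q) a b y) * ennreal y = 0" for y
    using False by (cases "y > 0") (auto simp: GG_density_def zero_less_mult_iff ennreal_neg)
  show ?thesis unfolding zero using False by (simp add: Gambel_density_def)
next
  case \<theta>: True
  define p where "p = phi q"
  have p: "p > 0" unfolding p_def using q by (rule phi_pos)
  have B: "Beta a b > 0" using a b by (simp add: Beta_def)
  have Gq: "Gamma (1 / q) > 0" using q by simp
  define z where "z = (p * \<theta>) powr q / \<xi>"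
  have z: "z > 0" using \<xi> p \<theta> by (simp add: z_def)
  define K where "K = q / (\<xi> powr (1 / q) * Gamma (1 / q))"
  have K: "K > 0" unfolding K_def using q \<xi> Gq by simp
  define F where "F y = K * exp (- ((\<theta> * y / \<xi> powr (1 / q)) powr q)) *
      (q * (y / p) powr (a * q - 1) * (1 + (y / p) powr q) powr (- (a + b)) / (p * Beta a b)) * y" for y
  define k where "k t = t powr (a + 1 / q - 1) * (1 + t) powr (- (a + b)) * exp (- (z * t))" for t
  define G where "G t = p * t powr (1 / q)" for t
  define G' where "G' t = p * (1 / q * t powr (1 / q - 1))" for t
  have Gpos: "G t > 0" if "t > 0" for t using that p by (simp add: G_def)
  have eq: "F (G t) * G' t = K * p / Beta a b * k t" if t: "t > 0" for t
  proof -
    have 1: "G t / p = t powr (1 / q)" using p by (simp add: G_def)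
    have 2: "(G t / p) powr q = t" unfolding 1 using t q by (simp add: powr_powr)
    have 3: "(G t / p) powr (a * q - 1) = t powr (a - 1 / q)"
      unfolding 1 using q by (simp add: powr_powr field_simps)
    have "\<theta> * G t / \<xi> powr (1 / q) = p * \<theta> * (t powr (1 / q) / \<xi> powr (1 / q))"
      by (simp add: G_def)
    also have "t powr (1 / q) / \<xi> powr (1 / q) = (t / \<xi>) powr (1 / q)"
      using t \<xi> by (simp add: powr_divide)
    finally have 4: "(\<theta> * G t / \<xi> powr (1 / q)) powr q = z * t"
      using p \<theta> t \<xi> q by (simp add: powr_mult powr_powr z_def)
    have "t powr (a - 1 / q) * t powr (1 / q) * t powr (1 / q - 1) = t powr (a + 1 / q - 1)"
      by (simp add: add_diff_eq flip: powr_add)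
    hence 5: "K * p / Beta a b * k t = K * p / Beta a b * ((t powr (a - 1 / q) * t powr (1 / q) * t powr (1 / q - 1)) * (1 + t) powr (- (a + b)) * exp (- (z * t)))"
      by (simp add: k_def)
    show ?thesis unfolding F_def 2 3 4 5 unfolding G_def G'_def using p q B by (simp add: field_simps)
  qed
  have E: "einterval (ereal 0) \<infinity> = {0<..}" by (auto simp: einterval_def)
  have aq: "a + 1 / q > 0" using a q by (simp add: add_pos_pos)
  have ki: "set_integrable lborel {0<..} k"
    unfolding k_def[abs_def] using aq a b z by (intro set_integrable_tricomi) auto
  have s1: "(G has_real_derivative G' t) (at t)" if "ereal 0 < ereal t" "ereal t < \<infinity>" for t
    unfolding G_def[abs_def] G'_def using that by (intro DERIV_cmult has_real_derivative_powr) auto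
  have s2: "isCont F (G t)" if "ereal 0 < ereal t" "ereal t < \<infinity>" for t
  proof -
    have "1 + (G t / p) powr q > 0" by (simp add: add_pos_nonneg)
    thus ?thesis
      using Gpos[of t] that p \<theta> \<xi> B unfolding F_def[abs_def] by (auto intro!: continuous_intros)
  qed
  have s3: "isCont G' t" if "ereal 0 < ereal t" "ereal t < \<infinity>" for t
    unfolding G'_def[abs_def] using that q by (auto intro!: continuous_intros)
  have Fpos: "F y \<ge> 0" if "y > 0" for y
    unfolding F_def using that K q p B by simp
  have s4: "0 \<le> F (G t)" if "ereal 0 < ereal t" "ereal t < \<infinity>" for t
    using that by (intro Fpos Gpos) simp
  have s5: "0 \<le> G' t" if "ereal 0 \<le> ereal t" "ereal t \<le> \<infinity>" for t
    using p q by (simp add: G'_def)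
  have "(G \<longlongrightarrow> 0) (at_right 0)" unfolding G_def[abs_def] using q p by real_asymp
  hence s6: "((ereal \<circ> G \<circ> real_of_ereal) \<longlongrightarrow> ereal 0) (at_right (ereal 0))"
    by (simp add: ereal_tendsto_simps)
  have "filterlim G at_top at_top" unfolding G_def[abs_def] using q p by real_asymp
  hence s7: "((ereal \<circ> G \<circ> real_of_ereal) \<longlongrightarrow> \<infinity>) (at_left \<infinity>)"
    by (simp add: ereal_tendsto_simps)
  have s8: "set_integrable lborel (einterval (ereal 0) \<infinity>) (\<lambda>t. F (G t) * G' t)"
    unfolding E using ki by (subst set_integrable_cong[OF refl refl eq]) auto
  \<comment> \<open>The substitution rule for nonnegative integrands also yields integrability of
    \<open>F\<close>, which the passage between \<open>nn_integral\<close> and the Lebesgue integral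
    needs.\<close>
  note subst = interval_integral_substitution_nonneg[of "ereal 0" \<infinity> G G' F, OF _ s1 s2 s3 s4 s5 s6 s7 s8]
  have Fi: "set_integrable lborel {0<..} F" using subst(1) unfolding E by simp
  have "(LINT y:{0<..}|lborel. F y) = (LINT t:{0<..}|lborel. F (G t) * G' t)"
    using subst(2) by (simp add: interval_integral_to_infinity_eq)
  also have "\<dots> = (LINT t:{0<..}|lborel. K * p / Beta a b * k t)"
    by (intro set_lebesgue_integral_cong) (auto simp: eq)
  also have "\<dots> = K * p / Beta a b * tricomi_integral (a + 1 / q) (a + b) z"
    by (simp add: tricomi_integral_def k_def)
  also have "tricomi_integral (a + 1 / q) (a + b) z = Gamma (a + 1 / q) * tricomi_Psi (a + 1 / q) (1 + 1 / q - b) z"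
    using tricomi_Psi_eq_integral[of "a + 1 / q" z "1 + 1 / q - b"] aq a b z by (simp add: add_ac)
  also have "K * p / Beta a b * \<dots> = Gambel_density q a b \<xi> \<theta>"
    using \<theta> by (simp add: Gambel_density_def K_def p_def z_def mult_ac)
  finally have F: "(LINT y:{0<..}|lborel. F y) = Gambel_density q a b \<xi> \<theta>" .
  have "(\<integral>\<^sup>+y. ennreal (GG_density (\<xi> powr (1 / q)) 1 q (\<theta> * y)) * ennreal (GB2_density q (phi q) a b y) * ennreal y \<partial>lborel)
     = (\<integral>\<^sup>+y. ennreal (indicator {0<..} y *\<^sub>R F y) \<partial>lborel)"
  proof (rule nn_integral_cong)
    fix y :: real
    show "ennreal (GG_density (\<xi> powr (1 / q)) 1 q (\<theta> * y)) * ennreal (GB2_density q (phi q) a b y) * ennreal y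
       = ennreal (indicator {0<..} y *\<^sub>R F y)"
    proof (cases "y > 0")
      case True
      have "GG_density (\<xi> powr (1 / q)) 1 q (\<theta> * y) = K * exp (- ((\<theta> * y / \<xi> powr (1 / q)) powr q))"
        using True \<theta> \<xi> by (simp add: GG_density_def K_def)
      moreover have "GB2_density q (phi q) a b y = q * (y / p) powr (a * q - 1) * (1 + (y / p) powr q) powr (- (a + b)) / (p * Beta a b)"
        using True by (simp add: GB2_density_def p_def)
      ultimately show ?thesis
        using True K p q B by (simp add: F_def ennreal_mult[symmetric])
    qed (simp add: ennreal_neg)
  qed
  also have "\<dots> = ennreal (LINT y:{0<..}|lborel. F y)"
    using Fi Fpos unfolding set_lebesgue_integral_def set_integrable_def
    by (intro nn_integral_eq_integral) (auto simp: indicator_def)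
  finally show ?thesis unfolding F .
qed

theorem theorem2:
  fixes q a b \<xi> :: real
    and M :: "'w measure"
    and X Y :: "'w \<Rightarrow> real"
  assumes "q > 0" and "a > 0" and "b > 0" and "\<xi> > 0"
    and "prob_space M"
    and "distributed M lborel X (\<lambda>x. ennreal (GG_density (\<xi> powr (1 / q)) 1 q x))"
    and "distributed M lborel Y (\<lambda>y. ennreal (GB2_density q (phi q) a b y))"
    and "prob_space.indep_var M borel X borel Y"
  shows "distributed M lborel (\<lambda>\<omega>. X \<omega> / Y \<omega>) (\<lambda>\<theta>. ennreal (Gambel_density q a b \<xi> \<theta>))"
proof -
  have "distributed M lborel (\<lambda>\<omega>. X \<omega> / Y \<omega>) (\<lambda>\<theta>. \<integral>\<^sup>+y.
      ennreal (GG_density (\<xi> powr (1 / q)) 1 q (\<theta> * y)) * ennreal (GB2_density q (phi q) a b y) * ennreal y \<partial>lborel)"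
    by (rule prob_space.distributed_divide[OF assms(5-8)]) (simp add: GB2_density_def)
  thus ?thesis
    unfolding nn_integral_quotient_density[OF assms(1-4)] .
qed

end
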